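(* Schur coupling (SC) of Banach space operators is not transitive, hence not an equivalence relation. That is, there exist complex Banach spaces $\mathcal{X},\mathcal{Z},\mathcal{Y}$ and operators $U\in\mathcal{B}(\mathcal{X})$, $W\in\mathcal{B}(\mathcal{Z})$, $V\in\mathcal{B}(\mathcal{Y})$ such that $U$ and $W$ are SC and $W$ and $V$ are SC, but $U$ and $V$ are not SC.
   Context: All Banach spaces are complex. $\mathcal{B}(\mathcal{V})$ is the space of bounded linear operators on $\mathcal{V}$; "invertible" means with bounded inverse. Schur coupled (SC): $U\in\mathcal{B}(\mathcal{X})$ and $V\in\mathcal{B}(\mathcal{Y})$ are SC if there exists a block operator $\begin{bmatrix}A&B\\C&D\end{bmatrix}\in\mathcal{B}(\mathcal{X}\oplus\mathcal{Y})$ with $A\in\mathcal{B}(\mathcal{X})$ and $D\in\mathcal{B}(\mathcal{Y})$ invertible such that $U=A-BD^{-1}C$ and $V=D-CA^{-1}B$. *)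

theory Defs
  imports "HOL-Analysis.Abstract_Metric_Spaces" "HOL-Algebra.Module"
    "HOL-Decision_Procs.Algebra_Aux"
begin

text \<open>
  Complex Banach spaces are represented with explicit carriers, so that one can quantify over
  them. A normed space is a module, in the sense of HOL-Algebra, over the field of complex
  numbers, with a norm. The multiplicative fields (mult and one) that the module record inherits
  from the ring record play no role.
\<close>

record 'a complex_normed_space = "(complex, 'a) module" +
  vnorm :: "'a \<Rightarrow> real"

locale complex_normed_space =
  Module.module "cring_class_ops :: complex ring" X
  for X :: "'a complex_normed_space" (structure) +
  assumes vnorm_nonneg: "x \<in> carrier X \<Longrightarrow> 0 \<le> vnorm X x"
    and vnorm_eq_0_iff: "x \<in> carrier X \<Longrightarrow> vnorm X x = 0 \<longleftrightarrow> x = \<zero>\<^bsub>X\<^esub>"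
    and vnorm_smult: "x \<in> carrier X \<Longrightarrow> vnorm X (c \<odot>\<^bsub>X\<^esub> x) = cmod c * vnorm X x"
    and vnorm_triangle:
      "x \<in> carrier X \<Longrightarrow> y \<in> carrier X \<Longrightarrow> vnorm X (x \<oplus>\<^bsub>X\<^esub> y) \<le> vnorm X x + vnorm X y"

text \<open>
  The locale Metric_space demands nonnegativity and symmetry of the distance also outside the
  carrier, hence the default value there.
\<close>

definition vdist :: "'a complex_normed_space \<Rightarrow> 'a \<Rightarrow> 'a \<Rightarrow> real" where
  "vdist X x y = (if x \<in> carrier X \<and> y \<in> carrier X then vnorm X (x \<ominus>\<^bsub>X\<^esub> y) else 0)"

lemma (in complex_normed_space) Metric_space_vdist: "Metric_space (carrier X) (vdist X)"
proof -
  have neg: "vnorm X (\<ominus>\<^bsub>X\<^esub> x) = vnorm X x" if x: "x \<in> carrier X" for x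
  proof -
    have "(- 1) \<odot>\<^bsub>X\<^esub> x \<oplus>\<^bsub>X\<^esub> x = ((- 1) \<odot>\<^bsub>X\<^esub> x) \<oplus>\<^bsub>X\<^esub> (1 \<odot>\<^bsub>X\<^esub> x)"
      using smult_one[OF x] by (simp add: cring_class_ops_def)
    also have "\<dots> = 0 \<odot>\<^bsub>X\<^esub> x"
      using smult_l_distr[of "- 1" 1 x] x by (simp add: cring_class_ops_def)
    also have "\<dots> = \<zero>\<^bsub>X\<^esub>"
      using smult_l_null[OF x] by (simp add: cring_class_ops_def)
    finally have "(- 1) \<odot>\<^bsub>X\<^esub> x \<oplus>\<^bsub>X\<^esub> x = \<zero>\<^bsub>X\<^esub>" .
    moreover have "(- 1) \<odot>\<^bsub>X\<^esub> x \<in> carrier X"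
      using smult_closed[of "- 1" x] x by (simp add: cring_class_ops_def)
    ultimately have "\<ominus>\<^bsub>X\<^esub> x = (- 1) \<odot>\<^bsub>X\<^esub> x"
      using x M.minus_equality by blast
    then show ?thesis using vnorm_smult[OF x, of "- 1"] by simp
  qed
  have eq: "x \<ominus>\<^bsub>X\<^esub> y = \<zero>\<^bsub>X\<^esub> \<longleftrightarrow> x = y" if "x \<in> carrier X" "y \<in> carrier X" for x y
    using that by (metis M.r_neg M.minus_eq M.minus_equality M.minus_minus M.a_inv_closed)
  have sym: "vnorm X (x \<ominus>\<^bsub>X\<^esub> y) = vnorm X (y \<ominus>\<^bsub>X\<^esub> x)"
    if "x \<in> carrier X" "y \<in> carrier X" for x y
  proof -
    have "y \<ominus>\<^bsub>X\<^esub> x = \<ominus>\<^bsub>X\<^esub> (x \<ominus>\<^bsub>X\<^esub> y)"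
      using that by (simp add: M.minus_eq M.minus_add M.a_comm)
    then show ?thesis using neg that by simp
  qed
  have tri: "vnorm X (x \<ominus>\<^bsub>X\<^esub> z) \<le> vnorm X (x \<ominus>\<^bsub>X\<^esub> y) + vnorm X (y \<ominus>\<^bsub>X\<^esub> z)"
    if "x \<in> carrier X" "y \<in> carrier X" "z \<in> carrier X" for x y z
  proof -
    have "x \<ominus>\<^bsub>X\<^esub> z = (x \<ominus>\<^bsub>X\<^esub> y) \<oplus>\<^bsub>X\<^esub> (y \<ominus>\<^bsub>X\<^esub> z)"
      using that by (simp add: M.minus_eq M.a_assoc M.r_neg1)
    then show ?thesis using vnorm_triangle that by simp
  qed
  show ?thesis
    by unfold_locales (auto simp: vdist_def vnorm_nonneg vnorm_eq_0_iff eq sym tri)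
qed

locale complex_banach_space = complex_normed_space +
  assumes complete: "Metric_space.mcomplete (carrier X) (vdist X)"

text \<open>
  Operators are functions on the whole type, of which only the values on the carrier matter;
  accordingly equality of operators is equality on the carrier throughout.
\<close>

definition bounded_operators ::
    "'a complex_normed_space \<Rightarrow> 'b complex_normed_space \<Rightarrow> ('a \<Rightarrow> 'b) set" where
  "bounded_operators X Y = {T \<in> carrier X \<rightarrow> carrier Y.
     (\<forall>x\<in>carrier X. \<forall>y\<in>carrier X. T (x \<oplus>\<^bsub>X\<^esub> y) = T x \<oplus>\<^bsub>Y\<^esub> T y) \<and>
     (\<forall>c. \<forall>x\<in>carrier X. T (c \<odot>\<^bsub>X\<^esub> x) = c \<odot>\<^bsub>Y\<^esub> T x) \<and>
     (\<exists>K. \<forall>x\<in>carrier X. vnorm Y (T x) \<le> K * vnorm X x)}"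

definition inverse_operator :: "'a complex_normed_space \<Rightarrow> ('a \<Rightarrow> 'a) \<Rightarrow> 'a \<Rightarrow> 'a" where
  "inverse_operator X T = inv_into (carrier X) T"

definition invertible_operator :: "'a complex_normed_space \<Rightarrow> ('a \<Rightarrow> 'a) \<Rightarrow> bool" where
  "invertible_operator X T \<longleftrightarrow> T \<in> bounded_operators X X \<and> bij_betw T (carrier X) (carrier X) \<and>
     inverse_operator X T \<in> bounded_operators X X"

text \<open>
  The direct sum carries the sum norm; any of the usual equivalent norms yields the same bounded
  operators.
\<close>

definition direct_sum ::
    "'a complex_normed_space \<Rightarrow> 'b complex_normed_space \<Rightarrow> ('a \<times> 'b) complex_normed_space" where
  "direct_sum X Y =
     \<lparr>carrier = carrier X \<times> carrier Y,
      monoid.mult = (\<lambda>(x, y) (x', y'). (x \<otimes>\<^bsub>X\<^esub> x', y \<otimes>\<^bsub>Y\<^esub> y')),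
      one = (\<one>\<^bsub>X\<^esub>, \<one>\<^bsub>Y\<^esub>),
      zero = (\<zero>\<^bsub>X\<^esub>, \<zero>\<^bsub>Y\<^esub>),
      add = (\<lambda>(x, y) (x', y'). (x \<oplus>\<^bsub>X\<^esub> x', y \<oplus>\<^bsub>Y\<^esub> y')),
      smult = (\<lambda>c (x, y). (c \<odot>\<^bsub>X\<^esub> x, c \<odot>\<^bsub>Y\<^esub> y)),
      vnorm = (\<lambda>(x, y). vnorm X x + vnorm Y y)\<rparr>"

definition block_operator ::
    "'a complex_normed_space \<Rightarrow> 'b complex_normed_space \<Rightarrow>
     ('a \<Rightarrow> 'a) \<Rightarrow> ('b \<Rightarrow> 'a) \<Rightarrow> ('a \<Rightarrow> 'b) \<Rightarrow> ('b \<Rightarrow> 'b) \<Rightarrow> 'a \<times> 'b \<Rightarrow> 'a \<times> 'b" where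
  "block_operator X Y A B C D = (\<lambda>(x, y). (A x \<oplus>\<^bsub>X\<^esub> B y, C x \<oplus>\<^bsub>Y\<^esub> D y))"

definition schur_coupled ::
    "'a complex_normed_space \<Rightarrow> ('a \<Rightarrow> 'a) \<Rightarrow> 'b complex_normed_space \<Rightarrow> ('b \<Rightarrow> 'b) \<Rightarrow> bool" where
  "schur_coupled X U Y V \<longleftrightarrow>
     (\<exists>A\<in>bounded_operators X X. \<exists>B\<in>bounded_operators Y X.
      \<exists>C\<in>bounded_operators X Y. \<exists>D\<in>bounded_operators Y Y.
        block_operator X Y A B C D \<in> bounded_operators (direct_sum X Y) (direct_sum X Y) \<and>
        invertible_operator X A \<and> invertible_operator Y D \<and>
        (\<forall>x\<in>carrier X. U x = A x \<ominus>\<^bsub>X\<^esub> B (inverse_operator Y D (C x))) \<and>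
        (\<forall>y\<in>carrier Y. V y = D y \<ominus>\<^bsub>Y\<^esub> C (inverse_operator X A (B y))))"

definition banach_operators :: "('a complex_normed_space \<times> ('a \<Rightarrow> 'a)) set" where
  "banach_operators = {(X, U). complex_banach_space X \<and> U \<in> bounded_operators X X}"

definition schur_coupling :: "('a complex_normed_space \<times> ('a \<Rightarrow> 'a)) rel" where
  "schur_coupling = {((X, U), (Y, V)).
     (X, U) \<in> banach_operators \<and> (Y, V) \<in> banach_operators \<and> schur_coupled X U Y V}"

end

theory Submission
  imports Defs "HOL-Library.Function_Algebras" "HOL-Analysis.L2_Norm"
begin

text \<open>
  The operators are the forward shifts U on l2 and V on c0.

  Any U is Schur coupled to its direct sum with an identity I, with A and D identities, C the
  inclusion of the summand and B the projection followed by I - U; the direct sum of I and V is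
  coupled to V in the same way. The invertible two-sided shift on the sum of l2 and c0 maps the
  direct sum of I and V to that of U and I, and composing with an invertible operator preserves
  Schur coupling. Hence the direct sum of U and I is coupled to both U and V.

  If U and V were coupled, V would be an invertible operator times I - T, where T factors as
  c0 \<rightarrow> l2 \<rightarrow> c0. Every operator c0 \<rightarrow> l2 is small on sequences supported far out, so T is compact and
  I - T satisfies the Fredholm alternative. But V is injective and not surjective.
\<close>

section \<open>Banach spaces of complex sequences\<close>

definition cscale :: "complex \<Rightarrow> (nat \<Rightarrow> complex) \<Rightarrow> nat \<Rightarrow> complex" where
  "cscale c x = (\<lambda>i. c * x i)"

lemma cscale_apply [simp]: "cscale c x i = c * x i"
  by (simp add: cscale_def)

text \<open>This supplies complex span and independence for the finite-dimensional step of the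
  Fredholm alternative.\<close>

interpretation cscale: vector_space cscale
  by unfold_locales (auto simp: fun_eq_iff algebra_simps)

text \<open>All three spaces are built over the one type \<open>nat \<Rightarrow> complex\<close>,
  since transitivity of \<open>schur_coupling\<close> is a statement about a relation on a single
  type.\<close>

definition seq_space ::
    "(nat \<Rightarrow> complex) set \<Rightarrow> ((nat \<Rightarrow> complex) \<Rightarrow> real) \<Rightarrow> (nat \<Rightarrow> complex) complex_normed_space" where
  "seq_space S N =
     \<lparr>carrier = S, monoid.mult = (*), one = 1, zero = 0, add = (+), smult = cscale, vnorm = N\<rparr>"

lemma seq_space_simps [simp]:
  "carrier (seq_space S N) = S"
  "\<zero>\<^bsub>seq_space S N\<^esub> = 0"
  "x \<oplus>\<^bsub>seq_space S N\<^esub> y = x + y"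
  "c \<odot>\<^bsub>seq_space S N\<^esub> x = cscale c x"
  "vnorm (seq_space S N) = N"
  by (simp_all add: seq_space_def)

locale seq_norm =
  fixes S :: "(nat \<Rightarrow> complex) set" and N :: "(nat \<Rightarrow> complex) \<Rightarrow> real"
  assumes zero_mem: "0 \<in> S"
    and add_mem: "x \<in> S \<Longrightarrow> y \<in> S \<Longrightarrow> x + y \<in> S"
    and scale_mem: "x \<in> S \<Longrightarrow> cscale c x \<in> S"
    and N_eq_0: "x \<in> S \<Longrightarrow> N x = 0 \<Longrightarrow> x = 0"
    and N_scale: "x \<in> S \<Longrightarrow> N (cscale c x) = cmod c * N x"
    and N_triangle: "x \<in> S \<Longrightarrow> y \<in> S \<Longrightarrow> N (x + y) \<le> N x + N y"
begin

lemma uminus_mem: "x \<in> S \<Longrightarrow> - x \<in> S"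
  using scale_mem[of x "-1"] by simp

lemma minus_mem: "x \<in> S \<Longrightarrow> y \<in> S \<Longrightarrow> x - y \<in> S"
  using add_mem[of x "- y"] uminus_mem by simp

lemma N_zero [simp]: "N 0 = 0"
  using N_scale[OF zero_mem, of 0] by simp

lemma N_uminus: "x \<in> S \<Longrightarrow> N (- x) = N x"
  using N_scale[of x "-1"] by simp

text \<open>As \<open>x\<close> and \<open>- x\<close> have the same norm and sum to
  \<open>0\<close>, the triangle inequality gives \<open>0 \<le> 2 * N x\<close>.\<close>

lemma N_nonneg: "x \<in> S \<Longrightarrow> 0 \<le> N x"
  using N_triangle[of x "- x"] N_uminus[of x] uminus_mem[of x] by simp

lemma N_minus: "x \<in> S \<Longrightarrow> y \<in> S \<Longrightarrow> N (x - y) \<le> N x + N y"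
  using N_triangle[of x "- y"] N_uminus uminus_mem by simp

sublocale seq_space: complex_normed_space "seq_space S N"
proof (intro complex_normed_space.intro moduleI abelian_groupI complex_normed_space_axioms.intro)
  show "\<exists>y\<in>carrier (seq_space S N). y \<oplus>\<^bsub>seq_space S N\<^esub> x = \<zero>\<^bsub>seq_space S N\<^esub>"
    if "x \<in> carrier (seq_space S N)" for x
    using that uminus_mem[of x] by (auto intro!: bexI[of _ "- x"])
  show "cring cring_class_ops" by (rule cring_class)
qed (auto simp: zero_mem add_mem scale_mem N_scale N_triangle N_nonneg N_eq_0 class_simps
       cscale.scale_left_distrib cscale.scale_right_distrib add.assoc add.commute)

lemma seq_space_minus [simp]:
  assumes "x \<in> S" "y \<in> S"
  shows "x \<ominus>\<^bsub>seq_space S N\<^esub> y = x - y"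
proof -
  have "\<ominus>\<^bsub>seq_space S N\<^esub> y = - y"
    using seq_space.M.minus_equality[of "- y" y] assms uminus_mem by simp
  then show ?thesis by (simp add: a_minus_def)
qed

text \<open>Within \<open>S\<close> the distance \<open>vdist\<close> is the norm of the difference,
  so \<open>mcomplete\<close> unfolds to the usual epsilon form of completeness.\<close>

lemma complex_banach_space_iff:
  "complex_banach_space (seq_space S N) \<longleftrightarrow>
     (\<forall>\<sigma> :: nat \<Rightarrow> nat \<Rightarrow> complex. (\<forall>n. \<sigma> n \<in> S) \<longrightarrow> (\<forall>e>0. \<exists>K. \<forall>m\<ge>K. \<forall>n\<ge>K. N (\<sigma> m - \<sigma> n) < e) \<longrightarrow>
        (\<exists>x\<in>S. \<forall>e>0. \<exists>K. \<forall>n\<ge>K. N (\<sigma> n - x) < e))"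
proof -
  interpret Metric_space S "vdist (seq_space S N)"
    using seq_space.Metric_space_vdist by simp
  have cau: "MCauchy \<sigma> \<longleftrightarrow>
      (\<forall>n. \<sigma> n \<in> S) \<and> (\<forall>e>0. \<exists>K. \<forall>m\<ge>K. \<forall>n\<ge>K. N (\<sigma> m - \<sigma> n) < e)"
    for \<sigma> :: "nat \<Rightarrow> nat \<Rightarrow> complex"
  proof (cases "\<forall>n. \<sigma> n \<in> S")
    case True
    then have "vdist (seq_space S N) (\<sigma> m) (\<sigma> n) = N (\<sigma> m - \<sigma> n)" for m n
      by (simp add: vdist_def)
    with True show ?thesis unfolding MCauchy_def by (simp add: image_subset_iff)
  qed (auto simp: MCauchy_def)
  have lim: "limitin mtopology \<sigma> x sequentially \<longleftrightarrow>
      x \<in> S \<and> (\<forall>e>0. \<exists>K. \<forall>n\<ge>K. N (\<sigma> n - x) < e)" if "\<forall>n. \<sigma> n \<in> S" for \<sigma> x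
    using that unfolding limit_metric_sequentially by (auto simp: vdist_def)
  have "complex_banach_space (seq_space S N) \<longleftrightarrow> mcomplete"
    unfolding complex_banach_space_def complex_banach_space_axioms_def
    using seq_space.complex_normed_space_axioms by simp
  moreover have "(MCauchy \<sigma> \<longrightarrow> (\<exists>x. limitin mtopology \<sigma> x sequentially)) \<longleftrightarrow>
      ((\<forall>n. \<sigma> n \<in> S) \<longrightarrow> (\<forall>e>0. \<exists>K. \<forall>m\<ge>K. \<forall>n\<ge>K. N (\<sigma> m - \<sigma> n) < e) \<longrightarrow>
        (\<exists>x\<in>S. \<forall>e>0. \<exists>K. \<forall>n\<ge>K. N (\<sigma> n - x) < e))" for \<sigma>
  proof (cases "\<forall>n. \<sigma> n \<in> S")
    case True
    then show ?thesis using cau[of \<sigma>] lim[OF True] by (simp add: Bex_def)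
  next
    case False
    then show ?thesis using cau[of \<sigma>] by blast
  qed
  ultimately show ?thesis unfolding mcomplete_def by simp
qed

text \<open>By \<open>coord\<close> a Cauchy sequence converges in each coordinate. The hypothesis
  \<open>limit\<close> places the pointwise limit in \<open>S\<close>, and \<open>fatou\<close>, the
  lower semicontinuity of the norm under pointwise limits, upgrades the convergence to convergence
  in norm.\<close>

lemma complex_banach_spaceI:
  assumes coord: "\<And>x i. x \<in> S \<Longrightarrow> cmod (x i) \<le> N x"
    and fatou: "\<And>\<tau> y e. \<lbrakk>\<And>n. \<tau> n \<in> S; \<And>n. N (\<tau> n) \<le> e; \<And>i. (\<lambda>n. \<tau> n i) \<longlonglongrightarrow> y i; y \<in> S\<rbrakk>
      \<Longrightarrow> N y \<le> e"
    and limit: "\<And>\<tau> y. \<lbrakk>\<And>n. \<tau> n \<in> S; \<forall>e>0. \<exists>K. \<forall>m\<ge>K. \<forall>n\<ge>K. N (\<tau> m - \<tau> n) < e;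
      \<And>i. (\<lambda>n. \<tau> n i) \<longlonglongrightarrow> y i\<rbrakk> \<Longrightarrow> y \<in> S"
  shows "complex_banach_space (seq_space S N)"
  unfolding complex_banach_space_iff
proof (intro allI impI)
  fix \<sigma> :: "nat \<Rightarrow> nat \<Rightarrow> complex"
  assume mem: "\<forall>n. \<sigma> n \<in> S"
    and cau: "\<forall>e>0. \<exists>K. \<forall>m\<ge>K. \<forall>n\<ge>K. N (\<sigma> m - \<sigma> n) < e"
  have "Cauchy (\<lambda>n. \<sigma> n i)" for i
  proof (rule metric_CauchyI)
    fix e :: real assume "0 < e"
    then obtain K where K: "\<forall>m\<ge>K. \<forall>n\<ge>K. N (\<sigma> m - \<sigma> n) < e" using cau by blast
    have "dist (\<sigma> m i) (\<sigma> n i) \<le> N (\<sigma> m - \<sigma> n)" for m n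
      using coord[OF minus_mem, of "\<sigma> m" "\<sigma> n" i] mem by (simp add: dist_norm)
    then show "\<exists>K. \<forall>m\<ge>K. \<forall>n\<ge>K. dist (\<sigma> m i) (\<sigma> n i) < e"
      using K by (meson order_le_less_trans)
  qed
  then have "\<exists>y. (\<lambda>n. \<sigma> n i) \<longlonglongrightarrow> y" for i
    using Cauchy_convergent convergent_def by blast
  then obtain x where x: "\<And>i. (\<lambda>n. \<sigma> n i) \<longlonglongrightarrow> x i" by metis
  have xS: "x \<in> S" using limit[OF _ cau x] mem by simp
  have "\<exists>K. \<forall>n\<ge>K. N (\<sigma> n - x) < e" if e: "e > 0" for e
  proof -
    obtain K where K: "\<forall>m\<ge>K. \<forall>n\<ge>K. N (\<sigma> m - \<sigma> n) < e/2" using cau e half_gt_zero by blast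
    \<comment> \<open>For fixed \<open>n\<close>, let the second index of the Cauchy estimate tend
      to infinity. The bound survives only as a weak inequality, hence \<open>e/2\<close>.\<close>
    have "N (\<sigma> n - x) \<le> e/2" if "n \<ge> K" for n
    proof (rule fatou[of "\<lambda>k. \<sigma> n - \<sigma> (k + K)"])
      show "(\<lambda>k. (\<sigma> n - \<sigma> (k + K)) i) \<longlonglongrightarrow> (\<sigma> n - x) i" for i
        using LIMSEQ_ignore_initial_segment[OF x[of i], of K] by (auto intro!: tendsto_diff)
      show "N (\<sigma> n - \<sigma> (k + K)) \<le> e/2" for k
        using K[rule_format, of n "k + K"] that by simp
    qed (use mem minus_mem xS in auto)
    with e have "\<forall>n\<ge>K. N (\<sigma> n - x) < e" by (auto intro: le_less_trans[of _ "e/2"])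
    then show ?thesis ..
  qed
  with xS show "\<exists>x\<in>S. \<forall>e>0. \<exists>K. \<forall>n\<ge>K. N (\<sigma> n - x) < e" by blast
qed

end

section \<open>Square-summable sequences and null sequences\<close>

definition l2 :: "(nat \<Rightarrow> complex) set" where
  "l2 = {x. summable (\<lambda>i. (cmod (x i))\<^sup>2)}"

definition l2norm :: "(nat \<Rightarrow> complex) \<Rightarrow> real" where
  "l2norm x = sqrt (\<Sum>i. (cmod (x i))\<^sup>2)"

lemma L2_set_le_l2norm: "x \<in> l2 \<Longrightarrow> finite I \<Longrightarrow> L2_set (\<lambda>i. cmod (x i)) I \<le> l2norm x"
  by (auto simp: L2_set_def l2norm_def l2_def intro!: sum_le_suminf)

text \<open>A common bound on the finite sections bounds the partial sums of the squares, which
  gives summability and the norm estimate at once.\<close>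

lemma l2_boundI:
  assumes "\<And>n. L2_set (\<lambda>i. cmod (x i)) {..<n} \<le> r"
  shows "x \<in> l2" "l2norm x \<le> r"
proof -
  have r: "r \<ge> 0" using assms[of 0] by simp
  have b: "(\<Sum>i<n. (cmod (x i))\<^sup>2) \<le> r\<^sup>2" for n
    using assms[of n] r unfolding L2_set_def by (simp add: real_sqrt_le_iff sqrt_le_D)
  have s: "summable (\<lambda>i. (cmod (x i))\<^sup>2)"
    by (rule bounded_imp_summable[where B = "r\<^sup>2"])
      (simp_all only: b zero_le_power2 flip: lessThan_Suc_atMost)
  then show "x \<in> l2" by (simp add: l2_def)
  show "l2norm x \<le> r"
    unfolding l2norm_def using suminf_le_const[OF s b] r by (simp add: real_le_lsqrt)
qed

lemma l2_add:
  assumes "x \<in> l2" "y \<in> l2"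
  shows "x + y \<in> l2" "l2norm (x + y) \<le> l2norm x + l2norm y"
proof -
  have "L2_set (\<lambda>i. cmod ((x + y) i)) {..<n} \<le> l2norm x + l2norm y" for n
  proof -
    have "L2_set (\<lambda>i. cmod ((x + y) i)) {..<n} \<le> L2_set (\<lambda>i. cmod (x i) + cmod (y i)) {..<n}"
      by (rule L2_set_mono) (auto intro: norm_triangle_ineq)
    also have "\<dots> \<le> L2_set (\<lambda>i. cmod (x i)) {..<n} + L2_set (\<lambda>i. cmod (y i)) {..<n}"
      by (rule L2_set_triangle_ineq)
    also have "\<dots> \<le> l2norm x + l2norm y"
      using assms by (intro add_mono L2_set_le_l2norm) auto
    finally show ?thesis .
  qed
  from l2_boundI[OF this] show "x + y \<in> l2" "l2norm (x + y) \<le> l2norm x + l2norm y" .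
qed

lemma l2norm_coord: "x \<in> l2 \<Longrightarrow> cmod (x i) \<le> l2norm x"
  using L2_set_le_l2norm[of x "{i}"] by simp

interpretation l2: seq_norm l2 l2norm
proof
  show "cscale c x \<in> l2" "l2norm (cscale c x) = cmod c * l2norm x" if "x \<in> l2" for c x
    using that by (auto simp: l2_def l2norm_def norm_mult power_mult_distrib suminf_mult
        real_sqrt_mult intro: summable_mult)
  show "x = 0" if "x \<in> l2" "l2norm x = 0" for x
    using l2norm_coord[OF that(1)] that(2) by (auto simp: fun_eq_iff)
qed (use l2_add in \<open>auto simp: l2_def\<close>)

text \<open>The tail estimate for operators from c0 to l2 rests on this property of l2. It is the
  identity for complex numbers in each coordinate, summed.\<close>

lemma l2norm_parallelogram:
  assumes "a \<in> l2" "b \<in> l2"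
  shows "(l2norm (a + b))\<^sup>2 + (l2norm (a - b))\<^sup>2 = 2 * (l2norm a)\<^sup>2 + 2 * (l2norm b)\<^sup>2"
proof -
  have sq: "(\<lambda>i. (cmod (x i))\<^sup>2) sums (l2norm x)\<^sup>2" if "x \<in> l2" for x
    using that by (simp add: l2_def l2norm_def suminf_nonneg summable_sums)
  have "(\<lambda>i. (cmod ((a + b) i))\<^sup>2 + (cmod ((a - b) i))\<^sup>2) sums
      ((l2norm (a + b))\<^sup>2 + (l2norm (a - b))\<^sup>2)"
    using assms by (intro sums_add sq l2.add_mem l2.minus_mem)
  moreover have "(\<lambda>i. 2 * (cmod (a i))\<^sup>2 + 2 * (cmod (b i))\<^sup>2) sums
      (2 * (l2norm a)\<^sup>2 + 2 * (l2norm b)\<^sup>2)"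
    using assms by (intro sums_add sums_mult sq)
  moreover have "(cmod ((a + b) i))\<^sup>2 + (cmod ((a - b) i))\<^sup>2 =
      2 * (cmod (a i))\<^sup>2 + 2 * (cmod (b i))\<^sup>2" for i
    unfolding cmod_power2 by (simp add: power2_eq_square algebra_simps)
  ultimately show ?thesis by (simp add: sums_unique2)
qed

lemma complex_banach_space_l2: "complex_banach_space (seq_space l2 l2norm)"
proof -
  \<comment> \<open>Membership is included because the statement serves twice: for lower
    semicontinuity of the norm, and for showing that the pointwise limit of a Cauchy sequence lies
    in \<open>l2\<close>.\<close>
  have fatou: "y \<in> l2 \<and> l2norm y \<le> e"
    if mem: "\<And>n. \<tau> n \<in> l2" and e: "\<And>n. l2norm (\<tau> n) \<le> e"
      and lim: "\<And>i. (\<lambda>n. \<tau> n i) \<longlonglongrightarrow> y i" for \<tau> y e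
  proof -
    have "L2_set (\<lambda>i. cmod (y i)) {..<k} \<le> e" for k
    proof (rule LIMSEQ_le_const2)
      show "(\<lambda>n. L2_set (\<lambda>i. cmod (\<tau> n i)) {..<k}) \<longlonglongrightarrow> L2_set (\<lambda>i. cmod (y i)) {..<k}"
        unfolding L2_set_def by (intro tendsto_intros lim)
      show "\<exists>N. \<forall>n\<ge>N. L2_set (\<lambda>i. cmod (\<tau> n i)) {..<k} \<le> e"
        using L2_set_le_l2norm mem e by (meson finite_lessThan order_trans)
    qed
    from l2_boundI[OF this] show ?thesis by simp
  qed
  show ?thesis
  proof (rule l2.complex_banach_spaceI)
    fix \<tau> y assume mem: "\<And>n. \<tau> n \<in> l2" and lim: "\<And>i. (\<lambda>n. \<tau> n i) \<longlonglongrightarrow> y i"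
      and "\<forall>e>0. \<exists>K. \<forall>m\<ge>K. \<forall>n\<ge>K. l2norm (\<tau> m - \<tau> n) < e"
    then obtain K where K: "\<forall>m\<ge>K. l2norm (\<tau> m - \<tau> K) < 1"
      by (meson order_refl zero_less_one)
    \<comment> \<open>From \<open>K\<close> on the sequence stays within distance 1 of
      \<open>\<tau> K\<close>, so dropping the initial terms makes it bounded without changing the
      pointwise limit.\<close>
    have "l2norm (\<tau> (n + K)) \<le> 1 + l2norm (\<tau> K)" for n
      using l2.N_triangle[OF l2.minus_mem[of "\<tau> (n + K)" "\<tau> K"], of "\<tau> K"] mem
        K[rule_format, of "n + K"] by simp
    then show "y \<in> l2"
      using fatou[OF mem _ LIMSEQ_ignore_initial_segment[OF lim]] by blast
  next
    fix \<tau> y e assume "\<And>n. \<tau> n \<in> l2" "\<And>n. l2norm (\<tau> n) \<le> e" "\<And>i. (\<lambda>n. \<tau> n i) \<longlonglongrightarrow> y i"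
    then show "l2norm y \<le> e" using fatou by blast
  qed (rule l2norm_coord)
qed

section \<open>The space c0 with the supremum norm\<close>

definition c0 :: "(nat \<Rightarrow> complex) set" where
  "c0 = {x. x \<longlonglongrightarrow> 0}"

definition supnorm :: "(nat \<Rightarrow> complex) \<Rightarrow> real" where
  "supnorm x = (SUP i. cmod (x i))"

lemma supnorm_coord:
  assumes "x \<in> c0" shows "cmod (x i) \<le> supnorm x"
proof -
  have "Bseq x" using assms convergent_imp_Bseq convergent_def by (auto simp: c0_def)
  then have "bdd_above (range (\<lambda>i. cmod (x i)))" by (auto simp: Bseq_def bdd_above_def)
  then show ?thesis unfolding supnorm_def using cSUP_upper[of i UNIV "\<lambda>i. cmod (x i)"] by simp
qed

lemma supnorm_le: "(\<And>i. cmod (x i) \<le> r) \<Longrightarrow> supnorm x \<le> r"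
  unfolding supnorm_def by (rule cSUP_least) auto

interpretation c0: seq_norm c0 supnorm
proof
  show "0 \<in> c0" by (simp add: c0_def zero_fun_def)
  show "x + y \<in> c0" if "x \<in> c0" "y \<in> c0" for x y
    using that tendsto_add[of x 0 _ y 0] by (simp add: c0_def plus_fun_def)
  show mem: "cscale c x \<in> c0" if "x \<in> c0" for c x
    using that tendsto_mult_right_zero[of x _ c] by (simp add: c0_def cscale_def)
  show "x = 0" if "x \<in> c0" "supnorm x = 0" for x
    using supnorm_coord[OF that(1)] that(2) by (auto simp: fun_eq_iff)
  \<comment> \<open>One inequality suffices: applied to the scalar \<open>inverse c\<close> it
    yields the reverse one.\<close>
  have le: "supnorm (cscale c x) \<le> cmod c * supnorm x" if "x \<in> c0" for c x
    using supnorm_coord[OF that] by (intro supnorm_le) (simp add: norm_mult mult_left_mono)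
  show "supnorm (cscale c x) = cmod c * supnorm x" if x: "x \<in> c0" for c x
  proof (cases "c = 0")
    case True
    then show ?thesis by (simp add: supnorm_def)
  next
    case False
    have "supnorm x = supnorm (cscale (inverse c) (cscale c x))" using False by simp
    also have "\<dots> \<le> inverse (cmod c) * supnorm (cscale c x)"
      using le[OF mem[OF x]] by (metis norm_inverse)
    finally show ?thesis using le[OF x, of c] False by (simp add: field_simps)
  qed
  show "supnorm (x + y) \<le> supnorm x + supnorm y" if "x \<in> c0" "y \<in> c0" for x y
    using supnorm_coord[OF that(1)] supnorm_coord[OF that(2)]
    by (intro supnorm_le) (auto intro: norm_triangle_mono)
qed

lemma complex_banach_space_c0: "complex_banach_space (seq_space c0 supnorm)"
proof (rule c0.complex_banach_spaceI[OF supnorm_coord])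
  fix \<tau> y e assume mem: "\<And>n. \<tau> n \<in> c0" and e: "\<And>n. supnorm (\<tau> n) \<le> e"
    and lim: "\<And>i. (\<lambda>n. \<tau> n i) \<longlonglongrightarrow> y i"
  show "supnorm y \<le> e"
  proof (rule supnorm_le)
    show "cmod (y i) \<le> e" for i
      using order_trans[OF supnorm_coord[OF mem] e]
      by (intro LIMSEQ_le_const2[OF tendsto_norm[OF lim]]) blast
  qed
next
  fix \<tau> y assume mem: "\<And>n. \<tau> n \<in> c0" and lim: "\<And>i. (\<lambda>n. \<tau> n i) \<longlonglongrightarrow> y i"
    and cau: "\<forall>e>0. \<exists>K. \<forall>m\<ge>K. \<forall>n\<ge>K. supnorm (\<tau> m - \<tau> n) < e"
  show "y \<in> c0"
    unfolding c0_def mem_Collect_eq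
  proof (rule LIMSEQ_I)
    fix e :: real assume e: "0 < e"
    then obtain K where K: "\<forall>m\<ge>K. \<forall>n\<ge>K. supnorm (\<tau> m - \<tau> n) < e/2"
      using cau half_gt_zero by blast
    \<comment> \<open>Passing to the limit in the Cauchy estimate shows that \<open>y\<close> is
      within \<open>e/2\<close> of \<open>\<tau> K\<close> uniformly in \<open>i\<close>; the null
      sequence \<open>\<tau> K\<close> then controls the far coordinates of
      \<open>y\<close>.\<close>
    have near: "cmod (y i - \<tau> K i) \<le> e/2" for i
    proof (rule LIMSEQ_le_const2[OF tendsto_norm[OF tendsto_diff[OF lim tendsto_const]]])
      have "cmod (\<tau> n i - \<tau> K i) \<le> e/2" if "n \<ge> K" for n
        using supnorm_coord[OF c0.minus_mem[OF mem mem], of n K i] K that by fastforce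
      then show "\<exists>M. \<forall>n\<ge>M. cmod (\<tau> n i - \<tau> K i) \<le> e/2" by blast
    qed
    have "\<tau> K \<longlonglongrightarrow> 0" using mem[of K] by (simp add: c0_def)
    from LIMSEQ_D[OF this, of "e/2"] e obtain M where M: "\<forall>i\<ge>M. cmod (\<tau> K i) < e/2"
      by auto
    have "cmod (y i - 0) < e" if "i \<ge> M" for i
      using near[of i] M[rule_format, OF that] norm_triangle_sub[of "y i" "\<tau> K i"] by simp
    then show "\<exists>M. \<forall>i\<ge>M. cmod (y i - 0) < e" by blast
  qed
qed

section \<open>Bounded operators between sequence spaces\<close>

lemma bounded_operators_seq_space_iff:
  "T \<in> bounded_operators (seq_space S N) (seq_space S' N') \<longleftrightarrow>
     (\<forall>x\<in>S. T x \<in> S') \<and> (\<forall>x\<in>S. \<forall>y\<in>S. T (x + y) = T x + T y) \<and>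
     (\<forall>c. \<forall>x\<in>S. T (cscale c x) = cscale c (T x)) \<and> (\<exists>K. \<forall>x\<in>S. N' (T x) \<le> K * N x)"
  by (auto simp: bounded_operators_def)

text \<open>This is for inverses: \<open>inverse_operator\<close> agrees with a given two-sided
  inverse on the carrier, but may take other values outside it.\<close>

lemma bounded_operators_cong:
  assumes "complex_normed_space X" "T \<in> bounded_operators X Y"
    and "\<And>x. x \<in> carrier X \<Longrightarrow> T' x = T x"
  shows "T' \<in> bounded_operators X Y"
proof -
  interpret complex_normed_space X by fact
  have "c \<odot>\<^bsub>X\<^esub> x \<in> carrier X" if "x \<in> carrier X" for c x
    using smult_closed[of c x] that by (simp add: class_simps)
  then show ?thesis using assms(2,3) by (auto simp: bounded_operators_def)
qed

lemma (in seq_norm) bounded_operators_minus: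
  assumes T: "T \<in> bounded_operators (seq_space S N) (seq_space S' N')"
    and x: "x \<in> S" and y: "y \<in> S"
  shows "T (x - y) = T x - T y"
proof -
  have "x - y = x + cscale (-1) y" by simp
  then have "T (x - y) = T x + cscale (-1) (T y)"
    using T x y scale_mem[OF y, of "-1"] unfolding bounded_operators_seq_space_iff by metis
  then show ?thesis by simp
qed

lemma (in seq_norm) bounded_operators_zero:
  assumes T: "T \<in> bounded_operators (seq_space S N) (seq_space S' N')"
  shows "T 0 = 0"
  using bounded_operators_minus[OF T zero_mem zero_mem] by simp

text \<open>The bound is made strictly positive so that later estimates can divide by it.\<close>

lemma (in seq_norm) bounded_operators_bound:
  assumes T: "T \<in> bounded_operators (seq_space S N) (seq_space S' N')"
  obtains K where "K > 0" "\<And>x. x \<in> S \<Longrightarrow> N' (T x) \<le> K * N x"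
proof -
  obtain K where K: "\<forall>x\<in>S. N' (T x) \<le> K * N x"
    using T unfolding bounded_operators_seq_space_iff by blast
  have "N' (T x) \<le> max K 1 * N x" if "x \<in> S" for x
    using K[rule_format, OF that] mult_right_mono[OF max.cobounded1[of K 1] N_nonneg[OF that]]
    by linarith
  then show thesis using that[of "max K 1"] by simp
qed

lemma (in seq_norm) bounded_operators_comp:
  assumes T: "T \<in> bounded_operators (seq_space S N) (seq_space S1 N1)"
    and R: "R \<in> bounded_operators (seq_space S1 N1) (seq_space S2 N2)"
    and S1: "seq_norm S1 N1"
  shows "(\<lambda>x. R (T x)) \<in> bounded_operators (seq_space S N) (seq_space S2 N2)"
proof -
  obtain K where K: "K > 0" "\<And>x. x \<in> S \<Longrightarrow> N1 (T x) \<le> K * N x"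
    using bounded_operators_bound[OF T] by blast
  obtain L where L: "L > 0" "\<And>x. x \<in> S1 \<Longrightarrow> N2 (R x) \<le> L * N1 x"
    using seq_norm.bounded_operators_bound[OF S1 R] by blast
  have "N2 (R (T x)) \<le> (L * K) * N x" if x: "x \<in> S" for x
  proof -
    have "T x \<in> S1" using T x unfolding bounded_operators_seq_space_iff by blast
    then have "N2 (R (T x)) \<le> L * N1 (T x)" by (rule L(2))
    also have "\<dots> \<le> L * (K * N x)" using K(2)[OF x] L(1) by simp
    finally show ?thesis by (simp add: mult.assoc)
  qed
  then show ?thesis using T R unfolding bounded_operators_seq_space_iff by auto
qed

lemma invertible_operatorI:
  assumes X: "complex_normed_space X"
    and T: "T \<in> bounded_operators X X" and R: "R \<in> bounded_operators X X"
    and RT: "\<And>x. x \<in> carrier X \<Longrightarrow> R (T x) = x" and TR: "\<And>x. x \<in> carrier X \<Longrightarrow> T (R x) = x"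
  shows "invertible_operator X T"
    and "x \<in> carrier X \<Longrightarrow> inverse_operator X T x = R x"
proof -
  have mem: "T x \<in> carrier X" "R x \<in> carrier X" if "x \<in> carrier X" for x
    using that T R by (auto simp: bounded_operators_def)
  have bij: "bij_betw T (carrier X) (carrier X)"
    by (rule bij_betw_byWitness[where f' = R]) (use mem RT TR in auto)
  have inv: "inverse_operator X T x = R x" if "x \<in> carrier X" for x
    unfolding inverse_operator_def
    using bij that mem TR by (metis bij_betw_imp_inj_on inv_into_f_f)
  then show "x \<in> carrier X \<Longrightarrow> inverse_operator X T x = R x" .
  show "invertible_operator X T"
    unfolding invertible_operator_def using T bij bounded_operators_cong[OF X R inv] by blast
qed

lemma block_operator_bounded:
  assumes "seq_norm S N" "seq_norm S' N'"
    and A: "A \<in> bounded_operators (seq_space S N) (seq_space S N)"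
    and B: "B \<in> bounded_operators (seq_space S' N') (seq_space S N)"
    and C: "C \<in> bounded_operators (seq_space S N) (seq_space S' N')"
    and D: "D \<in> bounded_operators (seq_space S' N') (seq_space S' N')"
  shows "block_operator (seq_space S N) (seq_space S' N') A B C D \<in>
    bounded_operators (direct_sum (seq_space S N) (seq_space S' N'))
      (direct_sum (seq_space S N) (seq_space S' N'))"
proof -
  interpret X: seq_norm S N by fact
  interpret Y: seq_norm S' N' by fact
  obtain K1 where K1: "K1 > 0" "\<And>x. x \<in> S \<Longrightarrow> N (A x) \<le> K1 * N x"
    using X.bounded_operators_bound[OF A] by blast
  obtain K2 where K2: "K2 > 0" "\<And>x. x \<in> S' \<Longrightarrow> N (B x) \<le> K2 * N' x"
    using Y.bounded_operators_bound[OF B] by blast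
  obtain K3 where K3: "K3 > 0" "\<And>x. x \<in> S \<Longrightarrow> N' (C x) \<le> K3 * N x"
    using X.bounded_operators_bound[OF C] by blast
  obtain K4 where K4: "K4 > 0" "\<And>x. x \<in> S' \<Longrightarrow> N' (D x) \<le> K4 * N' x"
    using Y.bounded_operators_bound[OF D] by blast
  note ops = A[unfolded bounded_operators_seq_space_iff] B[unfolded bounded_operators_seq_space_iff]
    C[unfolded bounded_operators_seq_space_iff] D[unfolded bounded_operators_seq_space_iff]
  \<comment> \<open>In the sum norm each of the four entries is bounded by its own constant times
    \<open>N x + N' y\<close>, so the constants add up.\<close>
  have bound: "N (A x + B y) + N' (C x + D y) \<le> (K1 + K2 + K3 + K4) * (N x + N' y)"
    if x: "x \<in> S" and y: "y \<in> S'" for x y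
  proof -
    have mem: "A x \<in> S" "B y \<in> S" "C x \<in> S'" "D y \<in> S'" using ops x y by simp_all
    have "N (A x + B y) \<le> K1 * N x + K2 * N' y"
      using X.N_triangle[OF mem(1,2)] K1(2)[OF x] K2(2)[OF y] by linarith
    moreover have "N' (C x + D y) \<le> K3 * N x + K4 * N' y"
      using Y.N_triangle[OF mem(3,4)] K3(2)[OF x] K4(2)[OF y] by linarith
    moreover have "0 \<le> K2 * N x" "0 \<le> K4 * N x" "0 \<le> K1 * N' y" "0 \<le> K3 * N' y"
      using X.N_nonneg[OF x] Y.N_nonneg[OF y] K1(1) K2(1) K3(1) K4(1) by simp_all
    ultimately show ?thesis by (simp add: algebra_simps)
  qed
  show ?thesis
    unfolding bounded_operators_def direct_sum_def block_operator_def
    using ops bound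
    by (auto simp: X.add_mem Y.add_mem cscale.scale_right_distrib add.assoc add.left_commute
        intro!: exI[of _ "K1 + K2 + K3 + K4"])
qed

text \<open>Neumann series: iterating \<open>\<lambda>z. x + L z\<close> from \<open>0\<close>
  produces its partial sums, which form a Cauchy sequence because \<open>L\<close> halves norms. The
  limit solves the equation.\<close>

lemma (in seq_norm) contraction_solve:
  assumes banach: "complex_banach_space (seq_space S N)"
    and L: "L \<in> bounded_operators (seq_space S N) (seq_space S N)"
    and half: "\<And>y. y \<in> S \<Longrightarrow> N (L y) \<le> N y / 2"
    and x: "x \<in> S"
  shows "\<exists>y\<in>S. y - L y = x"
proof -
  define y where "y n = ((\<lambda>z. x + L z) ^^ n) 0" for n
  have y0: "y 0 = 0" and ySuc: "y (Suc n) = x + L (y n)" for n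
    by (simp_all add: y_def)
  have LS: "L z \<in> S" if "z \<in> S" for z
    using L that unfolding bounded_operators_seq_space_iff by blast
  have yS: "y n \<in> S" for n
  proof (induction n)
    case 0
    show ?case unfolding y0 by (rule zero_mem)
  next
    case (Suc n)
    then show ?case unfolding ySuc by (intro add_mem x LS)
  qed
  have y_bound: "N (y n) \<le> 2 * N x" for n
  proof (induction n)
    case 0
    show ?case unfolding y0 N_zero using N_nonneg[OF x] by simp
  next
    case (Suc n)
    show ?case
      unfolding ySuc using N_triangle[OF x LS[OF yS[of n]]] half[OF yS[of n]] Suc by linarith
  qed
  \<comment> \<open>Lowering both indices by one removes one application of \<open>L\<close>, so
    \<open>n\<close> halvings lead back to \<open>y k - y 0\<close>, which \<open>y_bound\<close>
    controls independently of \<open>k\<close>.\<close>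
  have diff: "N (y (k + n) - y n) \<le> (1/2) ^ n * (2 * N x)" for k n
  proof (induction n)
    case (Suc n)
    have eq: "y (k + Suc n) - y (Suc n) = L (y (k + n) - y n)"
      using bounded_operators_minus[OF L yS yS] by (simp add: ySuc)
    have "(1/2) ^ Suc n * (2 * N x) = (1/2) ^ n * (2 * N x) / 2" by simp
    then show ?case unfolding eq using half[OF minus_mem[OF yS yS], of "k + n" n] Suc by linarith
  qed (simp add: y0 y_bound)
  have small: "\<exists>K. \<forall>n\<ge>K. (1/2) ^ n * (2 * N x) < e" if "e > 0" for e :: real
  proof -
    have "(\<lambda>n. (1/2) ^ n * (2 * N x)) \<longlonglongrightarrow> 0"
      by (intro tendsto_mult_left_zero LIMSEQ_power_zero) simp
    from order_tendstoD(2)[OF this that] show ?thesis by (simp add: eventually_sequentially)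
  qed
  have cau: "\<exists>K. \<forall>m\<ge>K. \<forall>n\<ge>K. N (y m - y n) < e" if e: "e > 0" for e :: real
  proof -
    obtain K where K: "\<forall>n\<ge>K. (1/2) ^ n * (2 * N x) < e" using small[OF e] by blast
    have le: "N (y m - y n) < e" if "n \<ge> K" "m \<ge> n" for m n
      using diff[of "m - n" n] K[rule_format, OF that(1)] that(2) by simp
    have sym: "N (y m - y n) = N (y n - y m)" for m n
      using N_uminus[OF minus_mem[OF yS yS], of m n] by simp
    have "N (y m - y n) < e" if "m \<ge> K" "n \<ge> K" for m n
      using le[of n m] le[of m n] that sym[of m n] by (cases "m \<ge> n") auto
    then show ?thesis by blast
  qed
  then obtain z where z: "z \<in> S" and lim: "\<forall>e>0. \<exists>K. \<forall>n\<ge>K. N (y n - z) < e"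
    using banach[unfolded complex_banach_space_iff, rule_format, of y] yS by blast
  have "N (z - L z - x) = 0"
  proof (rule ccontr)
    have mem: "z - L z - x \<in> S" using z x by (intro minus_mem LS)
    define e where "e = N (z - L z - x)"
    assume "N (z - L z - x) \<noteq> 0"
    then have "e > 0" using N_nonneg[OF mem] by (simp add: e_def)
    then obtain K where K: "\<forall>n\<ge>K. N (y n - z) < e / 2" using lim half_gt_zero by blast
    \<comment> \<open>The recursion for \<open>y (Suc K)\<close> expresses the residual by the
      errors of two consecutive iterates; these contribute less than \<open>e / 4\<close> and
      \<open>e / 2\<close>, contradicting that the residual has norm \<open>e\<close>.\<close>
    have "z - L z - x = L (y K - z) - (y (Suc K) - z)"
      using bounded_operators_minus[OF L yS z] by (simp add: ySuc)
    then have "e \<le> N (L (y K - z)) + N (y (Suc K) - z)"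
      unfolding e_def by (simp only:) (intro N_minus LS minus_mem yS z)
    moreover have "N (L (y K - z)) \<le> N (y K - z) / 2" by (intro half minus_mem yS z)
    moreover have "N (y K - z) < e / 2" "N (y (Suc K) - z) < e / 2" using K by auto
    ultimately show False using N_nonneg[OF minus_mem[OF yS z], of K] by linarith
  qed
  then have "z - L z - x = 0" by (rule N_eq_0[rotated]) (intro minus_mem LS z x)
  then have "z - L z = x" by simp
  with z show ?thesis by blast
qed

section \<open>Operators on null sequences that factor through square-summable sequences\<close>

text \<open>The equations \<open>trunc M z = 0\<close> and \<open>trunc M w = w\<close> will express
  that the support lies outside, respectively inside, the first \<open>M\<close>
  coordinates.\<close>

definition trunc :: "nat \<Rightarrow> (nat \<Rightarrow> complex) \<Rightarrow> nat \<Rightarrow> complex" where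
  "trunc M x = (\<lambda>i. if i < M then x i else 0)"

lemma trunc_add: "trunc M (x + y) = trunc M x + trunc M y"
  and trunc_minus: "trunc M (x - y) = trunc M x - trunc M y"
  and trunc_cscale: "trunc M (cscale c x) = cscale c (trunc M x)"
  and trunc_trunc: "trunc M (trunc M x) = trunc M x"
  and trunc_zero: "trunc M 0 = 0"
  by (auto simp: trunc_def fun_eq_iff)

lemma trunc_mem_c0: "trunc M x \<in> c0"
proof -
  have "\<forall>\<^sub>F i in sequentially. trunc M x i = 0"
    by (rule eventually_sequentiallyI[of M]) (simp add: trunc_def)
  then show ?thesis by (simp add: c0_def tendsto_eventually)
qed

lemma supnorm_trunc_diff_le:
  assumes "x \<in> c0" shows "supnorm (x - trunc M x) \<le> supnorm x"
proof (rule supnorm_le)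
  show "cmod ((x - trunc M x) i) \<le> supnorm x" for i
    using supnorm_coord[OF assms, of i] c0.N_nonneg[OF assms] by (simp add: trunc_def)
qed

lemma supnorm_trunc_diff_small:
  assumes x: "x \<in> c0" and e: "e > 0"
  shows "\<exists>M. supnorm (x - trunc M x) \<le> e"
proof -
  have "x \<longlonglongrightarrow> 0" using x by (simp add: c0_def)
  from LIMSEQ_D[OF this e] obtain M where M: "\<forall>i\<ge>M. cmod (x i) < e" by auto
  have "supnorm (x - trunc M x) \<le> e"
  proof (rule supnorm_le)
    show "cmod ((x - trunc M x) i) \<le> e" for i
      using M e by (cases "i < M") (simp_all add: trunc_def less_imp_le)
  qed
  then show ?thesis ..
qed

text \<open>
  If y nearly maximises the norm of B y over the unit ball of c0 and has finite support, then
  y + z and y - z stay in the unit ball whenever z does and is supported beyond y. By the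
  parallelogram law B z must therefore be small.
\<close>

lemma c0_l2_small_on_tails:
  assumes B: "B \<in> bounded_operators (seq_space c0 supnorm) (seq_space l2 l2norm)"
    and e: "e > 0"
  obtains M where "\<And>z. z \<in> c0 \<Longrightarrow> trunc M z = 0 \<Longrightarrow> l2norm (B z) \<le> e * supnorm z"
proof -
  obtain K where K: "K > 0" "\<And>x. x \<in> c0 \<Longrightarrow> l2norm (B x) \<le> K * supnorm x"
    using c0.bounded_operators_bound[OF B] by blast
  have Bmem: "B x \<in> l2" if "x \<in> c0" for x
    using B that unfolding bounded_operators_seq_space_iff by blast
  define R where "R = (\<lambda>y. l2norm (B y)) ` {y \<in> c0. supnorm y \<le> 1}"
  define s where "s = Sup R"
  have "l2norm (B y) \<le> K" if "y \<in> c0" "supnorm y \<le> 1" for y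
    using K(2)[OF that(1)] mult_left_mono[OF that(2) less_imp_le[OF K(1)]] by linarith
  then have bdd: "bdd_above R" by (auto simp: R_def bdd_above_def)
  have R0: "0 \<in> R"
    using c0.zero_mem c0.bounded_operators_zero[OF B] by (force simp: R_def)
  have le_s: "l2norm (B y) \<le> s" if "y \<in> c0" "supnorm y \<le> 1" for y
    unfolding s_def using bdd that by (intro cSup_upper) (auto simp: R_def)
  have s0: "s \<ge> 0" unfolding s_def using bdd R0 by (intro cSup_upper)
  \<comment> \<open>An image of norm at least \<open>r\<close> is close enough to the supremum: its
    square falls short of \<open>s\<^sup>2\<close> by at most \<open>e\<^sup>2\<close>. The
    \<open>max\<close> covers the case \<open>e > s\<close>.\<close>
  define r where "r = sqrt (max 0 (s\<^sup>2 - e\<^sup>2))"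
  \<comment> \<open>For \<open>s = 0\<close> there is no room below the supremum; in that case
    \<open>y = 0\<close> serves as the near maximiser.\<close>
  have "r < s \<or> s = 0"
  proof (cases "s = 0")
    case False
    then have "max 0 (s\<^sup>2 - e\<^sup>2) < s\<^sup>2" using s0 e by simp
    then show ?thesis unfolding r_def using s0 by (simp add: real_less_lsqrt)
  qed simp
  have "\<exists>M y. y \<in> c0 \<and> supnorm y \<le> 1 \<and> trunc M y = y \<and> s\<^sup>2 - e\<^sup>2 \<le> (l2norm (B y))\<^sup>2"
    using \<open>r < s \<or> s = 0\<close>
  proof
    assume "s = 0"
    then show ?thesis
      using c0.zero_mem by (intro exI[of _ 0]) (auto simp: trunc_zero)
  next
    assume "r < s"
    then obtain y where y: "y \<in> c0" "supnorm y \<le> 1" "r < l2norm (B y)"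
      using less_cSupD[of R r] R0 unfolding s_def R_def by blast
    \<comment> \<open>Truncating \<open>y\<close> with error at most \<open>d\<close> costs at most
      \<open>K * d\<close> in the image, which is exactly the margin of \<open>l2norm (B y)\<close>
      above \<open>r\<close>.\<close>
    define d where "d = (l2norm (B y) - r) / K"
    have "d > 0" using y(3) K(1) by (simp add: d_def)
    then obtain M where M: "supnorm (y - trunc M y) \<le> d"
      using supnorm_trunc_diff_small[OF y(1)] by blast
    have mem: "y - trunc M y \<in> c0" by (intro c0.minus_mem y(1) trunc_mem_c0)
    have "B y = B (trunc M y) + B (y - trunc M y)"
      using c0.bounded_operators_minus[OF B y(1) trunc_mem_c0] by simp
    then have "l2norm (B y) \<le> l2norm (B (trunc M y)) + l2norm (B (y - trunc M y))"
      using l2.N_triangle[OF Bmem Bmem] trunc_mem_c0 mem by metis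
    also have "l2norm (B (y - trunc M y)) \<le> K * d"
      using K(2)[OF mem] mult_left_mono[OF M less_imp_le[OF K(1)]] by linarith
    also have "K * d = l2norm (B y) - r" using K(1) by (simp add: d_def)
    finally have "r \<le> l2norm (B (trunc M y))" by simp
    then have "s\<^sup>2 - e\<^sup>2 \<le> (l2norm (B (trunc M y)))\<^sup>2"
      unfolding r_def using sqrt_le_D max.bounded_iff by blast
    moreover have "supnorm (trunc M y) \<le> 1"
    proof (rule supnorm_le)
      show "cmod (trunc M y i) \<le> 1" for i
        using supnorm_coord[OF y(1), of i] y(2) by (simp add: trunc_def)
    qed
    ultimately show ?thesis using trunc_mem_c0 trunc_trunc by blast
  qed
  then obtain M y where y: "y \<in> c0" "supnorm y \<le> 1" "trunc M y = y"
    and near: "s\<^sup>2 - e\<^sup>2 \<le> (l2norm (B y))\<^sup>2" by blast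
  have unit: "l2norm (B z) \<le> e" if z: "z \<in> c0" "trunc M z = 0" "supnorm z \<le> 1" for z
  proof -
    have coord: "cmod (y i + z i) \<le> 1 \<and> cmod (y i - z i) \<le> 1" for i
    proof (cases "i < M")
      case True
      then have "z i = 0" using fun_cong[OF z(2), of i] by (simp add: trunc_def)
      then show ?thesis using supnorm_coord[OF y(1), of i] y(2) by simp
    next
      case False
      then have "y i = 0" using fun_cong[OF y(3), of i] by (simp add: trunc_def)
      then show ?thesis using supnorm_coord[OF z(1), of i] z(3) by simp
    qed
    have "l2norm (B (y + z)) \<le> s" "l2norm (B (y - z)) \<le> s"
      using coord by (auto intro!: le_s supnorm_le c0.add_mem c0.minus_mem y(1) z(1))
    moreover have "B (y + z) = B y + B z" "B (y - z) = B y - B z"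
      using B y(1) z(1) c0.bounded_operators_minus[OF B]
      by (simp_all add: bounded_operators_seq_space_iff)
    ultimately have "(l2norm (B y + B z))\<^sup>2 \<le> s\<^sup>2" "(l2norm (B y - B z))\<^sup>2 \<le> s\<^sup>2"
      using l2.N_nonneg[OF l2.add_mem] l2.N_nonneg[OF l2.minus_mem] Bmem y(1) z(1)
      by (auto intro!: power_mono)
    \<comment> \<open>The left side of the parallelogram law is at most
      \<open>2 * s\<^sup>2\<close>, so the square of the norm of \<open>B z\<close> is at most
      \<open>s\<^sup>2 - (l2norm (B y))\<^sup>2\<close>, which \<open>near\<close> bounds by
      \<open>e\<^sup>2\<close>.\<close>
    then have "(l2norm (B z))\<^sup>2 \<le> e\<^sup>2"
      using l2norm_parallelogram[OF Bmem[OF y(1)] Bmem[OF z(1)]] near by linarith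
    then show ?thesis using e by (simp add: power2_le_iff_abs_le)
  qed
  have "l2norm (B z) \<le> e * supnorm z" if z: "z \<in> c0" "trunc M z = 0" for z
  proof (cases "supnorm z = 0")
    case True
    then show ?thesis using K(2)[OF z(1)] by simp
  next
    case False
    then have pos: "supnorm z > 0" using c0.N_nonneg[OF z(1)] by simp
    define w where "w = cscale (complex_of_real (inverse (supnorm z))) z"
    have "supnorm w \<le> 1" unfolding w_def c0.N_scale[OF z(1)] using pos by (simp add: norm_inverse)
    moreover have "w \<in> c0" "trunc M w = 0"
      unfolding w_def trunc_cscale z(2) using c0.scale_mem[OF z(1)] by simp_all
    ultimately have "l2norm (B w) \<le> e" using unit by blast
    moreover have "B w = cscale (complex_of_real (inverse (supnorm z))) (B z)"
      unfolding w_def using B z(1) by (simp add: bounded_operators_seq_space_iff)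
    then have "l2norm (B w) = inverse (supnorm z) * l2norm (B z)"
      unfolding l2.N_scale[OF Bmem[OF z(1)]] using pos l2.N_scale[OF Bmem[OF z(1)]] by (simp add: norm_inverse)
    ultimately show ?thesis using pos by (simp add: field_simps)
  qed
  then show thesis using that by blast
qed

text \<open>Dimension count in the space \<open>V\<close> of sequences supported in the first
  \<open>M\<close> coordinates: by injectivity the image of a basis is independent and of the same
  size, and a vector of \<open>V\<close> outside its span would give one independent vector too
  many.\<close>

lemma finitely_supported_inj_imp_surj:
  assumes lin: "Vector_Spaces.linear cscale cscale f"
    and supp: "\<And>w. trunc M (f w) = f w"
    and inj: "\<And>w. trunc M w = w \<Longrightarrow> f w = 0 \<Longrightarrow> w = 0"
    and b: "trunc M b = b"
  shows "\<exists>w. trunc M w = w \<and> f w = b"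
proof -
  interpret f: Vector_Spaces.linear cscale cscale f by fact
  define V where "V = {w. trunc M w = w}"
  have subsp: "cscale.subspace V"
    by (auto simp: V_def cscale.subspace_def trunc_add trunc_cscale trunc_zero)
  obtain B where B: "B \<subseteq> V" "cscale.independent B" "V \<subseteq> cscale.span B"
    by (rule cscale.maximal_independent_subset)
  have spanB: "cscale.span B = V"
    using B(1,3) cscale.span_minimal[OF _ subsp] by blast
  \<comment> \<open>The finitely many unit vectors span \<open>V\<close>, so the independent set
    \<open>B\<close> is finite.\<close>
  define E where "E = (\<lambda>j i. if i = j then 1 else 0 :: complex) ` {..<M}"
  have "V \<subseteq> cscale.span E"
  proof
    fix w assume "w \<in> V"
    then have "trunc M w i = w i" for i by (simp add: V_def)
    then have w: "w i = 0" if "\<not> i < M" for i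
      using that unfolding trunc_def by metis
    have "(\<Sum>j<n. cscale (w j) (\<lambda>i. if i = j then 1 else 0)) i = (if i < n then w i else 0)"
      for n i by (induction n) (auto simp: less_Suc_eq)
    with w have "w = (\<Sum>j<M. cscale (w j) (\<lambda>i. if i = j then 1 else 0))"
      by (auto simp: fun_eq_iff)
    moreover have "\<dots> \<in> cscale.span E"
      by (intro cscale.span_sum cscale.span_scale cscale.span_base) (auto simp: E_def)
    ultimately show "w \<in> cscale.span E" by simp
  qed
  then have finB: "finite B"
    using cscale.independent_span_bound[of E B] B(1,2) by (auto simp: E_def)
  have inj': "inj_on f (cscale.span B)"
    unfolding f.inj_on_iff_eq_0[OF cscale.subspace_span] using inj spanB by (auto simp: V_def)
  have ind: "cscale.independent (f ` B)"
    using f.independent_injective_image[OF B(2) inj'] .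
  have fV: "f ` B \<subseteq> V" using supp by (auto simp: V_def)
  have card: "card (f ` B) = card B"
    using inj_on_subset[OF inj' cscale.span_superset] by (rule card_image)
  have "b \<in> cscale.span (f ` B)"
  proof (rule ccontr)
    assume nb: "b \<notin> cscale.span (f ` B)"
    then have "cscale.independent (insert b (f ` B))"
      using ind by (simp add: cscale.independent_insert)
    moreover have "insert b (f ` B) \<subseteq> cscale.span B" using fV b spanB by (auto simp: V_def)
    ultimately have "card (insert b (f ` B)) \<le> card B"
      using cscale.independent_span_bound[OF finB] by blast
    moreover have "b \<notin> f ` B" using nb cscale.span_base by blast
    ultimately show False using finB card by simp
  qed
  then show ?thesis unfolding f.span_image spanB by (auto simp: V_def)
qed

text \<open>
  Fredholm alternative: T is the sum of a strict contraction L and a map that depends only on the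
  first M coordinates, and the latter reduces the equation to one in an M-dimensional space.
\<close>

lemma c0_inj_imp_surj:
  assumes T: "T \<in> bounded_operators (seq_space c0 supnorm) (seq_space c0 supnorm)"
    and tail: "\<And>z. z \<in> c0 \<Longrightarrow> trunc M z = 0 \<Longrightarrow> supnorm (T z) \<le> supnorm z / 2"
    and inj: "\<And>y. y \<in> c0 \<Longrightarrow> T y = y \<Longrightarrow> y = 0"
    and x: "x \<in> c0"
  shows "\<exists>y\<in>c0. y - T y = x"
proof -
  note T' = T[unfolded bounded_operators_seq_space_iff]
  define L where "L y = T (y - trunc M y)" for y
  have tmem: "y - trunc M y \<in> c0" if "y \<in> c0" for y
    using that by (intro c0.minus_mem trunc_mem_c0)
  have half: "supnorm (L y) \<le> supnorm y / 2" if "y \<in> c0" for y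
  proof -
    have "trunc M (y - trunc M y) = 0" by (simp add: trunc_minus trunc_trunc)
    from tail[OF tmem[OF that] this] supnorm_trunc_diff_le[OF that, of M] show ?thesis
      by (simp add: L_def)
  qed
  have Ladd: "L (y + z) = L y + L z" if "y \<in> c0" "z \<in> c0" for y z
  proof -
    have eq: "y + z - trunc M (y + z) = (y - trunc M y) + (z - trunc M z)" by (simp add: trunc_add)
    show ?thesis unfolding L_def eq using T' tmem that by blast
  qed
  have Lscale: "L (cscale c y) = cscale c (L y)" if "y \<in> c0" for c y
  proof -
    have eq: "cscale c y - trunc M (cscale c y) = cscale c (y - trunc M y)"
      by (simp add: trunc_cscale cscale.scale_right_diff_distrib)
    show ?thesis unfolding L_def eq using T' tmem that by blast
  qed
  have L: "L \<in> bounded_operators (seq_space c0 supnorm) (seq_space c0 supnorm)"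
    unfolding bounded_operators_seq_space_iff
    using T' tmem Ladd Lscale half by (auto simp: L_def intro!: exI[of _ "1/2"])
  \<comment> \<open>The difference is a fixed point of \<open>L\<close>, whose norm is at most half
    of itself. This uniqueness makes the solution map \<open>R\<close>, obtained by choice, additive
    and homogeneous.\<close>
  have uniq: "y = z" if "y \<in> c0" "z \<in> c0" "y - L y = z - L z" for y z
  proof -
    have mem: "y - z \<in> c0" by (intro c0.minus_mem that)
    have "L y - L z = y - z" using that(3) by (simp add: algebra_simps)
    then have "L (y - z) = y - z" using c0.bounded_operators_minus[OF L that(1,2)] by simp
    then have "supnorm (y - z) = 0" using half[OF mem] c0.N_nonneg[OF mem] by simp
    then show ?thesis using c0.N_eq_0[OF mem] by simp
  qed
  obtain R where R: "\<forall>u\<in>c0. R u \<in> c0 \<and> R u - L (R u) = u"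
    using c0.contraction_solve[OF complex_banach_space_c0 L half] by metis
  have Radd: "R (u + v) = R u + R v" if "u \<in> c0" "v \<in> c0" for u v
  proof (rule uniq)
    have "R u + R v - L (R u + R v) = (R u - L (R u)) + (R v - L (R v))"
      using R that Ladd[of "R u" "R v"] by (simp only: add_diff_add)
    then show "R (u + v) - L (R (u + v)) = R u + R v - L (R u + R v)"
      using R that c0.add_mem[OF that] by simp
  qed (use R that c0.add_mem in auto)
  have Rscale: "R (cscale c u) = cscale c (R u)" if "u \<in> c0" for c u
  proof (rule uniq)
    show "R (cscale c u) - L (R (cscale c u)) = cscale c (R u) - L (cscale c (R u))"
      using R that c0.scale_mem[OF that] Lscale[of "R u" c]
      by (simp flip: cscale.scale_right_diff_distrib)
  qed (use R that c0.scale_mem in auto)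
  have Tt: "T (trunc M w) \<in> c0" for w using T' trunc_mem_c0 by blast
  \<comment> \<open>Since \<open>T y = L y + T (trunc M y)\<close>, the equation
    \<open>y - T y = x\<close> amounts to \<open>y = R x + g w\<close> with
    \<open>w = trunc M y\<close>. Truncating turns it into \<open>f w = trunc M (R x)\<close>, an
    equation in the first \<open>M\<close> coordinates. The inner truncation makes \<open>f\<close>
    linear on all sequences.\<close>
  define g where "g w = R (T (trunc M w))" for w
  define f where "f w = trunc M (w - g w)" for w
  have g: "g w \<in> c0" "g w - L (g w) = T (trunc M w)" for w
    using R Tt by (simp_all add: g_def)
  have lin: "Vector_Spaces.linear cscale cscale f"
  proof unfold_locales
    show "f (v + w) = f v + f w" for v w
      using T' Tt Radd trunc_mem_c0 by (simp add: f_def g_def trunc_add trunc_minus)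
    show "f (cscale c w) = cscale c (f w)" for c w
      using T' Tt Rscale trunc_mem_c0
      by (simp add: f_def g_def trunc_cscale trunc_minus cscale.scale_right_diff_distrib)
  qed
  \<comment> \<open>If \<open>f w = 0\<close>, then \<open>g w\<close> truncates to
    \<open>w\<close>, and \<open>g w = L (g w) + T w\<close> says that \<open>g w\<close> is a fixed
    point of \<open>T\<close>.\<close>
  have f_inj: "w = 0" if w: "trunc M w = w" and "f w = 0" for w
  proof -
    have gw: "trunc M (g w) = w" using that by (simp add: f_def trunc_minus)
    have "T (g w) = T (g w - trunc M (g w)) + T (trunc M (g w))"
      using c0.bounded_operators_minus[OF T g(1) trunc_mem_c0] by simp
    also have "\<dots> = g w" using g(2)[of w] gw w by (simp add: L_def algebra_simps)
    finally have "g w = 0" using inj g(1) by blast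
    then show ?thesis using gw by (simp add: trunc_zero)
  qed
  obtain w where w: "trunc M w = w" "f w = trunc M (R x)"
    using finitely_supported_inj_imp_surj[OF lin _ f_inj trunc_trunc[of M "R x"]]
    by (auto simp: f_def trunc_trunc)
  define y where "y = R x + g w"
  have y: "y \<in> c0" using R x g(1) by (simp add: y_def c0.add_mem)
  have tw: "trunc M y = w"
    using w by (simp add: y_def f_def trunc_add trunc_minus algebra_simps)
  have "T y = L y + T w"
    using c0.bounded_operators_minus[OF T y trunc_mem_c0[of M y]] unfolding L_def tw by simp
  also have "L y = L (R x) + L (g w)" unfolding y_def using R x g(1) by (simp add: Ladd)
  finally have "y - T y = (R x - L (R x)) + (g w - L (g w)) - T w"
    unfolding y_def by (simp only: algebra_simps)
  then have "y - T y = x" using R x g(2)[of w] w(1) by simp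
  with y show ?thesis by blast
qed

section \<open>The sum of the two spaces\<close>

text \<open>Splitting and interleaving identify pairs of sequences with single sequences, so that
  the sum of l2 and c0 is again a space over \<open>nat \<Rightarrow> complex\<close>.\<close>

definition ev :: "(nat \<Rightarrow> complex) \<Rightarrow> nat \<Rightarrow> complex" where
  "ev z = (\<lambda>n. z (2 * n))"

definition od :: "(nat \<Rightarrow> complex) \<Rightarrow> nat \<Rightarrow> complex" where
  "od z = (\<lambda>n. z (2 * n + 1))"

definition interleave :: "(nat \<Rightarrow> complex) \<Rightarrow> (nat \<Rightarrow> complex) \<Rightarrow> nat \<Rightarrow> complex" where
  "interleave x y = (\<lambda>n. if even n then x (n div 2) else y (n div 2))"

lemma ev_interleave [simp]: "ev (interleave x y) = x"
  and od_interleave [simp]: "od (interleave x y) = y"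
  by (simp_all add: ev_def od_def interleave_def)

lemma interleave_ev_od [simp]: "interleave (ev z) (od z) = z"
proof
  show "interleave (ev z) (od z) n = z n" for n
    by (cases "even n") (auto simp: interleave_def ev_def od_def elim!: evenE oddE)
qed

lemma ev_od_zero [simp]: "ev 0 = 0" "od 0 = 0"
  and ev_od_add [simp]: "ev (x + y) = ev x + ev y" "od (x + y) = od x + od y"
  and ev_od_minus [simp]: "ev (x - y) = ev x - ev y" "od (x - y) = od x - od y"
  and ev_od_cscale [simp]: "ev (cscale c x) = cscale c (ev x)" "od (cscale c x) = cscale c (od x)"
  by (simp_all add: ev_def od_def fun_eq_iff)

lemma ev_od_eqI: "ev x = ev y \<Longrightarrow> od x = od y \<Longrightarrow> x = y"
  by (metis interleave_ev_od)

lemma interleave_add: "interleave (x + x') (y + y') = interleave x y + interleave x' y'"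
  and interleave_cscale: "interleave (cscale c x) (cscale c y) = cscale c (interleave x y)"
  by (rule ev_od_eqI; simp)+

definition l2c0 :: "(nat \<Rightarrow> complex) set" where
  "l2c0 = {z. ev z \<in> l2 \<and> od z \<in> c0}"

definition l2c0norm :: "(nat \<Rightarrow> complex) \<Rightarrow> real" where
  "l2c0norm z = l2norm (ev z) + supnorm (od z)"

interpretation l2c0: seq_norm l2c0 l2c0norm
proof
  show "x = 0" if "x \<in> l2c0" "l2c0norm x = 0" for x
  proof (rule ev_od_eqI)
    have mem: "ev x \<in> l2" "od x \<in> c0" using that(1) by (simp_all add: l2c0_def)
    then have "l2norm (ev x) = 0" "supnorm (od x) = 0"
      using that(2) l2.N_nonneg[OF mem(1)] c0.N_nonneg[OF mem(2)] by (simp_all add: l2c0norm_def)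
    then show "ev x = ev 0" "od x = od 0"
      using l2.N_eq_0[OF mem(1)] c0.N_eq_0[OF mem(2)] by simp_all
  qed
  show "l2c0norm (x + y) \<le> l2c0norm x + l2c0norm y" if "x \<in> l2c0" "y \<in> l2c0" for x y
    using l2.N_triangle[of "ev x" "ev y"] c0.N_triangle[of "od x" "od y"] that
    by (simp add: l2c0_def l2c0norm_def)
qed (auto simp: l2c0_def l2c0norm_def l2.zero_mem c0.zero_mem l2.add_mem c0.add_mem
      l2.scale_mem c0.scale_mem l2.N_scale c0.N_scale distrib_left)

text \<open>Completeness is inherited from the summands: both halves of a Cauchy sequence are
  Cauchy, and interleaving their limits gives the limit.\<close>

lemma complex_banach_space_l2c0: "complex_banach_space (seq_space l2c0 l2c0norm)"
  unfolding l2c0.complex_banach_space_iff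
proof (intro allI impI)
  fix \<sigma> :: "nat \<Rightarrow> nat \<Rightarrow> complex"
  assume "\<forall>n. \<sigma> n \<in> l2c0"
    and cau: "\<forall>e>0. \<exists>K. \<forall>m\<ge>K. \<forall>n\<ge>K. l2c0norm (\<sigma> m - \<sigma> n) < e"
  then have mem: "\<forall>n. ev (\<sigma> n) \<in> l2" "\<forall>n. od (\<sigma> n) \<in> c0" by (simp_all add: l2c0_def)
  have le: "l2norm (ev (\<sigma> m) - ev (\<sigma> n)) \<le> l2c0norm (\<sigma> m - \<sigma> n)"
      "supnorm (od (\<sigma> m) - od (\<sigma> n)) \<le> l2c0norm (\<sigma> m - \<sigma> n)" for m n
    using l2.N_nonneg[OF l2.minus_mem, of "ev (\<sigma> m)" "ev (\<sigma> n)"]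
      c0.N_nonneg[OF c0.minus_mem, of "od (\<sigma> m)" "od (\<sigma> n)"] mem
    by (simp_all add: l2c0norm_def)
  have "\<forall>e>0. \<exists>K. \<forall>m\<ge>K. \<forall>n\<ge>K. l2norm (ev (\<sigma> m) - ev (\<sigma> n)) < e"
    using cau order_le_less_trans[OF le(1)] by blast
  with complex_banach_space_l2[unfolded l2.complex_banach_space_iff, rule_format, of "\<lambda>n. ev (\<sigma> n)"]
  obtain x where x: "x \<in> l2" "\<forall>e>0. \<exists>K. \<forall>n\<ge>K. l2norm (ev (\<sigma> n) - x) < e"
    using mem(1) by blast
  have "\<forall>e>0. \<exists>K. \<forall>m\<ge>K. \<forall>n\<ge>K. supnorm (od (\<sigma> m) - od (\<sigma> n)) < e"
    using cau order_le_less_trans[OF le(2)] by blast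
  with complex_banach_space_c0[unfolded c0.complex_banach_space_iff, rule_format, of "\<lambda>n. od (\<sigma> n)"]
  obtain y where y: "y \<in> c0" "\<forall>e>0. \<exists>K. \<forall>n\<ge>K. supnorm (od (\<sigma> n) - y) < e"
    using mem(2) by blast
  have "\<exists>K. \<forall>n\<ge>K. l2c0norm (\<sigma> n - interleave x y) < e" if "e > 0" for e
  proof -
    have "e / 2 > 0" using that by simp
    then obtain K1 K2 where K1: "\<forall>n\<ge>K1. l2norm (ev (\<sigma> n) - x) < e / 2"
      and K2: "\<forall>n\<ge>K2. supnorm (od (\<sigma> n) - y) < e / 2" using x(2) y(2) by blast
    have "l2c0norm (\<sigma> n - interleave x y) < e" if "n \<ge> max K1 K2" for n
      using K1[rule_format, of n] K2[rule_format, of n] that by (simp add: l2c0norm_def)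
    then show ?thesis by blast
  qed
  moreover have "interleave x y \<in> l2c0" using x(1) y(1) by (simp add: l2c0_def)
  ultimately show "\<exists>x\<in>l2c0. \<forall>e>0. \<exists>K. \<forall>n\<ge>K. l2c0norm (\<sigma> n - x) < e" by blast
qed

section \<open>Shifts\<close>

definition lshift :: "(nat \<Rightarrow> complex) \<Rightarrow> nat \<Rightarrow> complex" where
  "lshift x = (\<lambda>n. x (Suc n))"

lemma lshift_case_nat [simp]: "lshift (case_nat a x) = x"
  by (simp add: lshift_def)

lemma case_nat_lshift [simp]: "case_nat (x 0) (lshift x) = x"
  by (simp add: lshift_def fun_eq_iff split: nat.split)

lemma lshift_add: "lshift (x + y) = lshift x + lshift y"
  and lshift_cscale: "lshift (cscale c x) = cscale c (lshift x)"
  by (simp_all add: lshift_def fun_eq_iff)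

lemma case_nat_add: "case_nat (a + b) (x + y) = case_nat a x + case_nat b (y :: nat \<Rightarrow> complex)"
  and case_nat_cscale: "case_nat (c * a) (cscale c x) = cscale c (case_nat a x)"
  by (simp_all add: fun_eq_iff split: nat.split)

section \<open>Boundedness of the one-sided shifts\<close>

lemma l2_lshift:
  assumes "x \<in> l2" shows "lshift x \<in> l2" "l2norm (lshift x) \<le> l2norm x"
proof -
  have "L2_set (\<lambda>i. cmod (lshift x i)) {..<n} \<le> l2norm x" for n
  proof -
    have "L2_set (\<lambda>i. cmod (lshift x i)) {..<n} = L2_set (\<lambda>i. cmod (x i)) (Suc ` {..<n})"
      by (simp add: L2_set_def lshift_def sum.reindex)
    also have "\<dots> \<le> l2norm x" using assms by (intro L2_set_le_l2norm) auto
    finally show ?thesis .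
  qed
  from l2_boundI[OF this] show "lshift x \<in> l2" "l2norm (lshift x) \<le> l2norm x" .
qed

lemma l2_case_nat:
  assumes "x \<in> l2" shows "case_nat a x \<in> l2" "l2norm (case_nat a x) \<le> cmod a + l2norm x"
proof -
  have "L2_set (\<lambda>i. cmod (case_nat a x i)) {..<n} \<le> cmod a + l2norm x" for n
  proof -
    \<comment> \<open>With one more index, splitting off the new entry \<open>a\<close> leaves
      exactly the section of length \<open>n\<close> of \<open>x\<close>.\<close>
    have "L2_set (\<lambda>i. cmod (case_nat a x i)) {..<n} \<le> L2_set (\<lambda>i. cmod (case_nat a x i)) {..<Suc n}"
      unfolding L2_set_def by (intro real_sqrt_le_mono sum_mono2) auto
    also have "{..<Suc n} = insert 0 (Suc ` {..<n})"
      by (rule lessThan_Suc_eq_insert_0)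
    also have "L2_set (\<lambda>i. cmod (case_nat a x i)) (insert 0 (Suc ` {..<n})) =
        sqrt ((cmod a)\<^sup>2 + (L2_set (\<lambda>i. cmod (x i)) {..<n})\<^sup>2)"
      by (simp add: L2_set_def sum.reindex sum_nonneg)
    also have "\<dots> \<le> cmod a + L2_set (\<lambda>i. cmod (x i)) {..<n}"
      by (rule sqrt_sum_squares_le_sum) (simp_all add: L2_set_nonneg)
    also have "\<dots> \<le> cmod a + l2norm x" using L2_set_le_l2norm[OF assms] by simp
    finally show ?thesis .
  qed
  from l2_boundI[OF this]
  show "case_nat a x \<in> l2" "l2norm (case_nat a x) \<le> cmod a + l2norm x" .
qed

lemma c0_lshift:
  assumes "x \<in> c0" shows "lshift x \<in> c0" "supnorm (lshift x) \<le> supnorm x"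
  using assms supnorm_coord[OF assms]
  by (auto simp: c0_def lshift_def filterlim_sequentially_Suc intro!: supnorm_le)

lemma c0_case_nat:
  assumes "x \<in> c0" shows "case_nat a x \<in> c0" "supnorm (case_nat a x) \<le> cmod a + supnorm x"
proof -
  have "(\<lambda>n. case_nat a x (Suc n)) \<longlonglongrightarrow> 0" using assms by (simp add: c0_def)
  then show "case_nat a x \<in> c0" unfolding c0_def by (simp only: filterlim_sequentially_Suc mem_Collect_eq)
  show "supnorm (case_nat a x) \<le> cmod a + supnorm x"
  proof (rule supnorm_le)
    show "cmod (case_nat a x i) \<le> cmod a + supnorm x" for i
      using supnorm_coord[OF assms, of "i - 1"] c0.N_nonneg[OF assms]
      by (cases i) (auto intro: order_trans)
  qed
qed

text \<open>The same function acts as the shift on l2 and on c0; the two operators differ only in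
  their carrier.\<close>

definition rshift :: "(nat \<Rightarrow> complex) \<Rightarrow> nat \<Rightarrow> complex" where
  "rshift x = case_nat 0 x"

lemma rshift_linear: "rshift (x + y) = rshift x + rshift y" "rshift (cscale c x) = cscale c (rshift x)"
  using case_nat_add[of 0 0 x y] case_nat_cscale[of c 0 x] by (simp_all add: rshift_def)

lemma rshift_bounded:
  "rshift \<in> bounded_operators (seq_space l2 l2norm) (seq_space l2 l2norm)"
  "rshift \<in> bounded_operators (seq_space c0 supnorm) (seq_space c0 supnorm)"
  using l2_case_nat[of _ 0] c0_case_nat[of _ 0]
  by (auto simp: bounded_operators_seq_space_iff rshift_linear intro!: exI[of _ 1])
    (simp_all add: rshift_def)

text \<open>
  The even and the odd coordinates, read as ... 4, 2, 0, 1, 3, 5 ..., form a two-sided sequence;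
  these are its two shifts.
\<close>

definition bishift :: "(nat \<Rightarrow> complex) \<Rightarrow> nat \<Rightarrow> complex" where
  "bishift z = interleave (case_nat (od z 0) (ev z)) (lshift (od z))"

definition bishift_inv :: "(nat \<Rightarrow> complex) \<Rightarrow> nat \<Rightarrow> complex" where
  "bishift_inv z = interleave (lshift (ev z)) (case_nat (ev z 0) (od z))"

lemma bishift_bishift_inv: "bishift (bishift_inv z) = z"
  and bishift_inv_bishift: "bishift_inv (bishift z) = z"
  by (simp_all add: bishift_def bishift_inv_def)

lemma bishift_bounded:
  "bishift \<in> bounded_operators (seq_space l2c0 l2c0norm) (seq_space l2c0 l2c0norm)"
proof -
  \<comment> \<open>The entry that crosses into the l2 half is bounded by the norm of the c0 half,
    which therefore counts twice.\<close>
  have "l2c0norm (bishift z) \<le> 2 * l2c0norm z" if "z \<in> l2c0" for z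
  proof -
    have mem: "ev z \<in> l2" "od z \<in> c0" using that by (simp_all add: l2c0_def)
    show ?thesis
      using l2_case_nat(2)[OF mem(1), of "od z 0"] c0_lshift(2)[OF mem(2)]
        supnorm_coord[OF mem(2), of 0] l2.N_nonneg[OF mem(1)]
      by (simp add: l2c0norm_def bishift_def)
  qed
  then show ?thesis
    unfolding bounded_operators_seq_space_iff
    by (auto simp: l2c0_def bishift_def l2_case_nat c0_lshift case_nat_add case_nat_cscale
        lshift_add lshift_cscale interleave_add interleave_cscale)
qed

lemma bishift_inv_bounded:
  "bishift_inv \<in> bounded_operators (seq_space l2c0 l2c0norm) (seq_space l2c0 l2c0norm)"
proof -
  have "l2c0norm (bishift_inv z) \<le> 2 * l2c0norm z" if "z \<in> l2c0" for z
  proof -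
    have mem: "ev z \<in> l2" "od z \<in> c0" using that by (simp_all add: l2c0_def)
    show ?thesis
      using c0_case_nat(2)[OF mem(2), of "ev z 0"] l2_lshift(2)[OF mem(1)]
        l2norm_coord[OF mem(1), of 0] c0.N_nonneg[OF mem(2)]
      by (simp add: l2c0norm_def bishift_inv_def)
  qed
  then show ?thesis
    unfolding bounded_operators_seq_space_iff
    by (auto simp: l2c0_def bishift_inv_def c0_case_nat l2_lshift case_nat_add case_nat_cscale
        lshift_add lshift_cscale interleave_add interleave_cscale)
qed

section \<open>Schur couplings of the shifts\<close>

definition rshift_sum_id :: "(nat \<Rightarrow> complex) \<Rightarrow> nat \<Rightarrow> complex" where
  "rshift_sum_id z = interleave (rshift (ev z)) (od z)"

lemma (in seq_norm) bounded_operators_id: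
  "(\<lambda>x. x) \<in> bounded_operators (seq_space S N) (seq_space S N)"
  by (auto simp: bounded_operators_seq_space_iff intro!: exI[of _ 1])

lemma (in seq_norm) invertible_operator_id:
  "invertible_operator (seq_space S N) (\<lambda>x. x)"
  "x \<in> S \<Longrightarrow> inverse_operator (seq_space S N) (\<lambda>x. x) x = x"
  using invertible_operatorI[OF seq_space.complex_normed_space_axioms
      bounded_operators_id bounded_operators_id] by simp_all

lemma (in seq_norm) bounded_operators_id_minus:
  assumes T: "T \<in> bounded_operators (seq_space S N) (seq_space S N)"
  shows "(\<lambda>x. x - T x) \<in> bounded_operators (seq_space S N) (seq_space S N)"
proof -
  obtain K where K: "\<And>x. x \<in> S \<Longrightarrow> N (T x) \<le> K * N x"
    using bounded_operators_bound[OF T] by blast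
  have "N (x - T x) \<le> (1 + K) * N x" if "x \<in> S" for x
  proof -
    have "T x \<in> S" using T that unfolding bounded_operators_seq_space_iff by blast
    from N_minus[OF that this] K[OF that] show ?thesis by (simp add: algebra_simps)
  qed
  then show ?thesis
    using T unfolding bounded_operators_seq_space_iff
    by (auto simp: minus_mem cscale.scale_right_diff_distrib)
qed

lemma ev_bounded: "ev \<in> bounded_operators (seq_space l2c0 l2c0norm) (seq_space l2 l2norm)"
  and od_bounded: "od \<in> bounded_operators (seq_space l2c0 l2c0norm) (seq_space c0 supnorm)"
  by (auto simp: bounded_operators_seq_space_iff l2c0_def l2c0norm_def l2.N_nonneg c0.N_nonneg
      intro!: exI[of _ 1])

lemma interleave_bounded:
  "(\<lambda>x. interleave x 0) \<in> bounded_operators (seq_space l2 l2norm) (seq_space l2c0 l2c0norm)"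
  "interleave 0 \<in> bounded_operators (seq_space c0 supnorm) (seq_space l2c0 l2c0norm)"
  using interleave_add[of _ _ 0 0] interleave_add[of 0 0]
    interleave_cscale[of _ _ 0] interleave_cscale[of _ 0]
  by (auto simp: bounded_operators_seq_space_iff l2c0_def l2c0norm_def l2.zero_mem c0.zero_mem
      intro!: exI[of _ 1])

lemma rshift_sum_id_bounded:
  "rshift_sum_id \<in> bounded_operators (seq_space l2c0 l2c0norm) (seq_space l2c0 l2c0norm)"
proof -
  have "l2c0norm (rshift_sum_id z) \<le> 1 * l2c0norm z" if "z \<in> l2c0" for z
    using l2_case_nat(2)[of "ev z" 0] that
    by (simp add: l2c0norm_def l2c0_def rshift_sum_id_def rshift_def)
  then show ?thesis
    unfolding bounded_operators_seq_space_iff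
    by (auto simp: l2c0_def rshift_sum_id_def rshift_linear interleave_add interleave_cscale)
      (auto simp: rshift_def l2_case_nat intro!: exI[of _ 1])
qed

text \<open>With identities on the diagonal, the conditions are that \<open>I - B C\<close> is the
  shift and \<open>I - C B\<close> the sum of shift and identity. Both hold because \<open>B\<close>
  reads only the even half, where it is \<open>I - rshift\<close>, and \<open>C\<close> writes only
  there.\<close>

lemma rshift_l2_coupled_sum:
  "schur_coupled (seq_space l2 l2norm) rshift (seq_space l2c0 l2c0norm) rshift_sum_id"
proof -
  define B where "B z = ev z - rshift (ev z)" for z
  have B: "B \<in> bounded_operators (seq_space l2c0 l2c0norm) (seq_space l2 l2norm)"
    unfolding B_def using l2c0.bounded_operators_comp[OF ev_bounded
      l2.bounded_operators_id_minus[OF rshift_bounded(1)] l2.seq_norm_axioms] .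
  note C = interleave_bounded(1)
  have mem: "interleave x 0 \<in> l2c0" if "x \<in> l2" for x
    using that by (simp add: l2c0_def c0.zero_mem)
  have Bmem: "B z \<in> l2" if "z \<in> l2c0" for z
    using B that unfolding bounded_operators_seq_space_iff by blast
  have U: "x - B (interleave x 0) = rshift x" for x
    by (simp add: B_def)
  have W: "z - interleave (B z) 0 = rshift_sum_id z" for z
    by (rule ev_od_eqI) (simp_all add: rshift_sum_id_def B_def)
  show ?thesis
    unfolding schur_coupled_def
    by (intro bexI[OF _ l2.bounded_operators_id] bexI[OF _ B] bexI[OF _ C]
        bexI[OF _ l2c0.bounded_operators_id] conjI ballI
        block_operator_bounded l2.seq_norm_axioms l2c0.seq_norm_axioms
        l2.bounded_operators_id l2c0.bounded_operators_id B C
        l2.invertible_operator_id l2c0.invertible_operator_id)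
      (simp_all add: l2.invertible_operator_id l2c0.invertible_operator_id mem Bmem U W)
qed

text \<open>Take the analogous coupling of the sum of \<open>I\<close> and \<open>rshift\<close>
  with \<open>rshift\<close> on c0, and multiply its first row by \<open>bishift\<close>. This
  multiplies the first operator by \<open>bishift\<close> and leaves \<open>V\<close> alone, since
  the inverse of \<open>A\<close> times \<open>B\<close> does not change.\<close>

lemma sum_coupled_rshift_c0:
  "schur_coupled (seq_space l2c0 l2c0norm) rshift_sum_id (seq_space c0 supnorm) rshift"
proof -
  define B where "B y = bishift (interleave 0 y)" for y
  define C where "C z = od z - rshift (od z)" for z
  have B: "B \<in> bounded_operators (seq_space c0 supnorm) (seq_space l2c0 l2c0norm)"
    unfolding B_def using c0.bounded_operators_comp[OF interleave_bounded(2) bishift_bounded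
      l2c0.seq_norm_axioms] .
  have C: "C \<in> bounded_operators (seq_space l2c0 l2c0norm) (seq_space c0 supnorm)"
    unfolding C_def using l2c0.bounded_operators_comp[OF od_bounded
      c0.bounded_operators_id_minus[OF rshift_bounded(2)] c0.seq_norm_axioms] .
  have Bmem: "B y \<in> l2c0" if "y \<in> c0" for y
    using B that unfolding bounded_operators_seq_space_iff by blast
  have Cmem: "C z \<in> c0" if "z \<in> l2c0" for z
    using C that unfolding bounded_operators_seq_space_iff by blast
  have Amem: "bishift z \<in> l2c0" "bishift_inv z \<in> l2c0" if "z \<in> l2c0" for z
    using bishift_bounded bishift_inv_bounded that unfolding bounded_operators_seq_space_iff
    by blast+
  note A = invertible_operatorI[OF l2c0.seq_space.complex_normed_space_axioms bishift_bounded
      bishift_inv_bounded bishift_inv_bishift bishift_bishift_inv]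
  \<comment> \<open>The left side is \<open>bishift\<close> applied to the sequence with halves
    \<open>ev z\<close> and \<open>rshift (od z)\<close>: the leading zero of the odd half moves to
    the front of the even half, which undoes one shift and creates the other.\<close>
  have W: "bishift z - B (C z) = rshift_sum_id z" for z
    by (rule ev_od_eqI)
      (simp_all add: rshift_sum_id_def B_def C_def bishift_def rshift_def fun_eq_iff lshift_def
        split: nat.split)
  have V: "y - C (bishift_inv (B y)) = rshift y" for y
    by (simp add: B_def C_def bishift_inv_bishift)
  show ?thesis
    unfolding schur_coupled_def
    by (intro bexI[OF _ bishift_bounded] bexI[OF _ B] bexI[OF _ C]
        bexI[OF _ c0.bounded_operators_id] conjI ballI
        block_operator_bounded l2c0.seq_norm_axioms c0.seq_norm_axioms
        bishift_bounded c0.bounded_operators_id B C A(1) c0.invertible_operator_id(1))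
      (simp_all add: A(2) c0.invertible_operator_id Amem Bmem Cmem W V)
qed

text \<open>A coupling would make \<open>rshift\<close> on c0 equal to \<open>D (I - T)\<close> with
  \<open>D\<close> invertible. Injectivity forces surjectivity for \<open>I - T\<close>, but not for
  \<open>rshift\<close>.\<close>

lemma not_rshift_l2_coupled_rshift_c0:
  "\<not> schur_coupled (seq_space l2 l2norm) rshift (seq_space c0 supnorm) rshift"
proof
  let ?X = "seq_space l2 l2norm" and ?Y = "seq_space c0 supnorm"
  assume "schur_coupled ?X rshift ?Y rshift"
  then obtain A B C D where B: "B \<in> bounded_operators ?Y ?X" and C: "C \<in> bounded_operators ?X ?Y"
    and A: "invertible_operator ?X A" and D: "invertible_operator ?Y D"
    and V: "\<forall>y\<in>c0. rshift y = D y \<ominus>\<^bsub>?Y\<^esub> C (inverse_operator ?X A (B y))"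
    unfolding schur_coupled_def by auto
  define A' where "A' = inverse_operator ?X A"
  define D' where "D' = inverse_operator ?Y D"
  have A': "A' \<in> bounded_operators ?X ?X" and D': "D' \<in> bounded_operators ?Y ?Y"
    and D0: "D \<in> bounded_operators ?Y ?Y" and bij: "bij_betw D c0 c0"
    using A D by (simp_all add: invertible_operator_def A'_def D'_def)
  have D'D: "D' (D y) = y" if "y \<in> c0" for y
    using bij that unfolding D'_def inverse_operator_def
    by (simp add: bij_betw_def)
  have DD': "D (D' y) = y" if "y \<in> c0" for y
    using bij that unfolding D'_def inverse_operator_def
    by (simp add: bij_betw_def f_inv_into_f)
  define B' where "B' y = A' (B y)" for y
  define C' where "C' x = D' (C x)" for x
  define T where "T y = C' (B' y)" for y
  have B': "B' \<in> bounded_operators ?Y ?X"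
    unfolding B'_def by (rule c0.bounded_operators_comp[OF B A' l2.seq_norm_axioms])
  have C': "C' \<in> bounded_operators ?X ?Y"
    unfolding C'_def by (rule l2.bounded_operators_comp[OF C D' c0.seq_norm_axioms])
  have T: "T \<in> bounded_operators ?Y ?Y"
    unfolding T_def by (rule c0.bounded_operators_comp[OF B' C' l2.seq_norm_axioms])
  have mem: "B' y \<in> l2" "C (B' y) \<in> c0" "D y \<in> c0" "D' y \<in> c0" "T y \<in> c0" if "y \<in> c0" for y
    using B' C D0 D' T that unfolding bounded_operators_seq_space_iff by simp_all
  have diff: "D' (rshift y) = y - T y" if y: "y \<in> c0" for y
  proof -
    have "rshift y = D y - C (B' y)"
      using V mem y by (simp add: B'_def A'_def)
    then show ?thesis
      using c0.bounded_operators_minus[OF D' mem(3)[OF y] mem(2)[OF y]] D'D[OF y]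
      by (simp add: T_def C'_def)
  qed
  have rmem: "rshift y \<in> c0" if "y \<in> c0" for y
    using c0_case_nat(1)[OF that] by (simp add: rshift_def)
  obtain K where K: "K > 0" "\<And>x. x \<in> l2 \<Longrightarrow> supnorm (C' x) \<le> K * l2norm x"
    using l2.bounded_operators_bound[OF C'] by blast
  \<comment> \<open>The constant compensates the bound \<open>K\<close> of \<open>C'\<close>, so
    that the composite \<open>T\<close> has norm at most one half on tails.\<close>
  obtain M where M: "\<And>z. z \<in> c0 \<Longrightarrow> trunc M z = 0 \<Longrightarrow> l2norm (B' z) \<le> 1 / (2 * K) * supnorm z"
    using c0_l2_small_on_tails[OF B', of "1 / (2 * K)"] K(1) by auto
  have tail: "supnorm (T z) \<le> supnorm z / 2" if z: "z \<in> c0" "trunc M z = 0" for z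
  proof -
    have "supnorm (T z) \<le> K * l2norm (B' z)" unfolding T_def by (rule K(2)[OF mem(1)[OF z(1)]])
    also have "\<dots> \<le> K * (1 / (2 * K) * supnorm z)"
      using M[OF z] K(1) by (intro mult_left_mono) auto
    also have "\<dots> = supnorm z / 2" using K(1) by simp
    finally show ?thesis .
  qed
  have inj: "y = 0" if y: "y \<in> c0" "T y = y" for y
  proof -
    have "D' (rshift y) = 0" using diff[OF y(1)] y(2) by simp
    then have "rshift y = D 0" using DD'[OF rmem[OF y(1)]] by simp
    then have "rshift y = 0" using c0.bounded_operators_zero[OF D0] by simp
    then have "lshift (rshift y) = lshift 0" by simp
    then show ?thesis by (simp add: rshift_def) (simp add: lshift_def fun_eq_iff)
  qed
  \<comment> \<open>The first unit vector lies outside the range of \<open>rshift\<close>; a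
    solution of \<open>y - T y = D' d\<close> would be a preimage of it.\<close>
  define d where "d = case_nat (1 :: complex) 0"
  have d: "d \<in> c0" unfolding d_def by (rule c0_case_nat(1)[OF c0.zero_mem])
  obtain y where y: "y \<in> c0" "y - T y = D' d"
    using c0_inj_imp_surj[OF T tail inj mem(4)[OF d]] by blast
  have "rshift y = D (D' (rshift y))" using DD'[OF rmem[OF y(1)]] by simp
  also have "\<dots> = d" unfolding diff[OF y(1)] y(2) by (rule DD'[OF d])
  finally have "rshift y 0 = d 0" by simp
  then show False by (simp add: rshift_def d_def)
qed

theorem corollary4p1:
  shows "\<not> trans (schur_coupling :: ((nat \<Rightarrow> complex) complex_normed_space \<times> _) rel) \<and>
    \<not> equiv banach_operators (schur_coupling :: ((nat \<Rightarrow> complex) complex_normed_space \<times> _) rel) \<and>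
    (\<exists>(X :: (nat \<Rightarrow> complex) complex_normed_space) (Z :: (nat \<Rightarrow> complex) complex_normed_space)
      (Y :: (nat \<Rightarrow> complex) complex_normed_space) U W V.
      complex_banach_space X \<and> complex_banach_space Z \<and> complex_banach_space Y \<and>
      U \<in> bounded_operators X X \<and> W \<in> bounded_operators Z Z \<and> V \<in> bounded_operators Y Y \<and>
      schur_coupled X U Z W \<and> schur_coupled Z W Y V \<and> \<not> schur_coupled X U Y V)"
proof -
  let ?X = "seq_space l2 l2norm" and ?Z = "seq_space l2c0 l2c0norm" and ?Y = "seq_space c0 supnorm"
  note facts = complex_banach_space_l2 complex_banach_space_l2c0 complex_banach_space_c0
    rshift_bounded(1) rshift_sum_id_bounded rshift_bounded(2)
    rshift_l2_coupled_sum sum_coupled_rshift_c0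
  have "((?X, rshift), (?Z, rshift_sum_id)) \<in> schur_coupling"
    "((?Z, rshift_sum_id), (?Y, rshift)) \<in> schur_coupling"
    "((?X, rshift), (?Y, rshift)) \<notin> schur_coupling"
    using facts not_rshift_l2_coupled_rshift_c0
    by (simp_all add: schur_coupling_def banach_operators_def)
  then have "\<not> trans (schur_coupling :: ((nat \<Rightarrow> complex) complex_normed_space \<times> _) rel)"
    by (meson transD)
  moreover from this
  have "\<not> equiv banach_operators (schur_coupling :: ((nat \<Rightarrow> complex) complex_normed_space \<times> _) rel)"
    by (auto elim: equivE)
  ultimately show ?thesis using facts not_rshift_l2_coupled_rshift_c0 by blast
qed

end
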